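(* Fix $R\in\mathbb N$ and a compact set $K\subset(0,1)$. For $p\in K$ let $q=1-p$, $X\sim\mathrm{Bin}(N,p)$, $\nu=\lceil Np\rceil$ and $h=h_N=\nu-Np\in[0,1)$. As $N\to\infty$, uniformly for $p\in K$ and integers $r$ with $|r|\le R$, $$\Pr\{X=\nu+r\}\sim\frac{Np}{Np+h+r}\cdot\frac{1}{\sqrt{2\pi Npq}}\,\exp\Bigl(\sum_{k\ge1}\frac1{N^k}\Bigl[\widetilde A_k(h;p)-\frac{\Xi_k(p)}{k}S_k(h,r)\Bigr]\Bigr),$$ and equivalently $$\Pr\{X=\nu+r\}\sim\frac{1}{\sqrt{2\pi(\nu+r)(N-\nu-r)/N}}\,\exp\Bigl(\sum_{k\ge1}\frac1{N^k}\Bigl[\widehat A_k(h;p)-\frac{\Xi_k(p)}{k}T_k(h,r)\Bigr]\Bigr).$$ The meaning of each expansion is the following. Write $P$ for the displayed prefactor and $a_k$ for the bracket multiplying $N^{-k}$ in the exponent. For every integer $M\ge0$ there are constants $C,N_0$, depending only on $M,K,R$, such that for all integers $N\ge N_0$, all $p\in K$ and all integers $|r|\le R$, the prefactor is well defined and $$\Pr\{X=\nu+r\}=P\,\exp\Bigl(\sum_{k=1}^{M}\frac{a_k}{N^k}\Bigr)(1+\varepsilon),\qquad|\varepsilon|\le CN^{-M-1}.$$ Equivalently, if the exponential is re-expanded multiplicatively as the formal series $\exp\bigl(\sum_{k\ge1}a_kN^{-k}\bigr)=\sum_{n\ge0}C_nN^{-n}$ (with $C_0=1$ and $C_n$ a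 polynomial in $a_1,\dots,a_n$) and truncated after the term $N^{-M}$, then the relative remainder is $O(N^{-M-1})$: $\Pr\{X=\nu+r\}=P\bigl[\sum_{n=0}^{M}C_nN^{-n}+O(N^{-M-1})\bigr]$, uniformly in $|r|\le R$ and $p\in K$.
   Context: $B_n(t)$ are the Bernoulli polynomials, $\sum_{n\ge0}B_n(t)z^n/n!=\frac{z}{e^z-1}e^{tz}$, $B_n=B_n(0)$ (so $B_1=-\tfrac12$), and $\widehat B_n(t)=\tfrac12\bigl[B_n(t)+B_n(t+1)\bigr]$. For $k\ge1$ define $$\Xi_k(p)=\frac{(-1)^{k+1}}{p^k}+\frac1{q^k},\quad \widetilde A_k(t;p)=\frac{(-1)^{k+1}B_{k+1}-\Xi_k(p)B_{k+1}(t)}{k(k+1)},\quad \widehat A_k(t;p)=\frac{(-1)^{k+1}B_{k+1}-\Xi_k(p)\widehat B_{k+1}(t)}{k(k+1)}.$$ The power sums are: for $r\ge1$, $$S_k(h,r)=\sum_{j=0}^{r-1}(h+j)^k,\qquad T_k(h,r)=\tfrac12h^k+\sum_{j=1}^{r-1}(h+j)^k+\tfrac12(h+r)^k;$$ $S_k(h,0)=T_k(h,0)=0$; and for $r\le-1$, $$S_k(h,r)=-\sum_{j=1}^{-r}(h-j)^k,\qquad T_k(h,r)=-\Bigl[\tfrac12(h+r)^k+\sum_{j=1}^{-r-1}(h-j)^k+\tfrac12h^k\Bigr].$$ *)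

theory Defs
  imports "HOL-Probability.Probability"
begin

definition bernoulli_fps :: "real \<Rightarrow> real fps" where
  "bernoulli_fps t = fps_X / (fps_exp 1 - 1) * fps_exp t"

definition bernpoly :: "nat \<Rightarrow> real \<Rightarrow> real" where
  "bernpoly n t = fact n * fps_nth (bernoulli_fps t) n"

definition bernoulli :: "nat \<Rightarrow> real" where
  "bernoulli n = bernpoly n 0"

definition bernpoly_avg :: "nat \<Rightarrow> real \<Rightarrow> real" where
  "bernpoly_avg n t = (bernpoly n t + bernpoly n (t + 1)) / 2"

text \<open>The quotient of formal power series above is exact: the denominator has subdegree 1.\<close>

lemma bernoulli_fps_times: "bernoulli_fps t * (fps_exp 1 - 1) = fps_X * fps_exp t"
proof -
  have nz: "fps_nth (fps_exp 1 - 1 :: real fps) 1 \<noteq> 0" by simp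
  then have ne: "(fps_exp 1 - 1 :: real fps) \<noteq> 0" by (metis fps_zero_nth)
  have "subdegree (fps_exp 1 - 1 :: real fps) \<le> 1" using nz by (rule subdegree_leI)
  then have "(fps_exp 1 - 1 :: real fps) dvd fps_X"
    using ne by (subst fps_dvd_iff) auto
  then have "fps_X / (fps_exp 1 - 1 :: real fps) * (fps_exp 1 - 1) = fps_X"
    by (rule dvd_div_mult_self)
  then show ?thesis unfolding bernoulli_fps_def by (metis mult.assoc mult.commute)
qed

lemma bernoulli_0: "bernoulli 0 = 1" and bernoulli_1: "bernoulli 1 = - 1 / 2"
proof -
  let ?b = "bernoulli_fps 0"
  have "fps_nth (?b * (fps_exp 1 - 1)) 1 = 1" "fps_nth (?b * (fps_exp 1 - 1)) 2 = 0"
    unfolding bernoulli_fps_times by simp_all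
  then have "fps_nth ?b 0 = 1" "fps_nth ?b 0 / 2 + fps_nth ?b 1 = 0"
    by (simp_all add: fps_mult_nth numeral_2_eq_2)
  then show "bernoulli 0 = 1" "bernoulli 1 = - 1 / 2"
    by (simp_all add: bernoulli_def bernpoly_def)
qed

text \<open>Throughout, \<open>q = 1 - p\<close>.\<close>

definition Xi :: "nat \<Rightarrow> real \<Rightarrow> real" where
  "Xi k p = (- 1) ^ (k + 1) / p ^ k + 1 / (1 - p) ^ k"

definition A_tilde :: "nat \<Rightarrow> real \<Rightarrow> real \<Rightarrow> real" where
  "A_tilde k t p = ((- 1) ^ (k + 1) * bernoulli (k + 1) - Xi k p * bernpoly (k + 1) t)
     / (real k * real (k + 1))"

definition A_hat :: "nat \<Rightarrow> real \<Rightarrow> real \<Rightarrow> real" where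
  "A_hat k t p = ((- 1) ^ (k + 1) * bernoulli (k + 1) - Xi k p * bernpoly_avg (k + 1) t)
     / (real k * real (k + 1))"

definition S_sum :: "nat \<Rightarrow> real \<Rightarrow> int \<Rightarrow> real" where
  "S_sum k h r =
     (if r \<ge> 1 then \<Sum>j\<in>{0..r-1}. (h + of_int j) ^ k
      else if r = 0 then 0
      else - (\<Sum>j\<in>{1..-r}. (h - of_int j) ^ k))"

definition T_sum :: "nat \<Rightarrow> real \<Rightarrow> int \<Rightarrow> real" where
  "T_sum k h r =
     (if r \<ge> 1 then h ^ k / 2 + (\<Sum>j\<in>{1..r-1}. (h + of_int j) ^ k) + (h + of_int r) ^ k / 2
      else if r = 0 then 0
      else - ((h + of_int r) ^ k / 2 + (\<Sum>j\<in>{1..-r-1}. (h - of_int j) ^ k) + h ^ k / 2))"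

definition nu :: "nat \<Rightarrow> real \<Rightarrow> int" where
  "nu N p = \<lceil>real N * p\<rceil>"

definition hh :: "nat \<Rightarrow> real \<Rightarrow> real" where
  "hh N p = of_int (nu N p) - real N * p"

definition bin_prob :: "nat \<Rightarrow> real \<Rightarrow> int \<Rightarrow> real" where
  "bin_prob N p r = measure_pmf.prob (binomial_pmf N p) {x. int x = nu N p + r}"

definition pre1 :: "nat \<Rightarrow> real \<Rightarrow> int \<Rightarrow> real" where
  "pre1 N p r = real N * p / (real N * p + hh N p + of_int r)
     * (1 / sqrt (2 * pi * real N * p * (1 - p)))"

definition pre1_wd :: "nat \<Rightarrow> real \<Rightarrow> int \<Rightarrow> bool" where
  "pre1_wd N p r \<longleftrightarrow> real N * p + hh N p + of_int r \<noteq> 0 \<and> 2 * pi * real N * p * (1 - p) > 0"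

definition pre2 :: "nat \<Rightarrow> real \<Rightarrow> int \<Rightarrow> real" where
  "pre2 N p r = 1 / sqrt (2 * pi * of_int (nu N p + r) * of_int (int N - nu N p - r) / real N)"

definition pre2_wd :: "nat \<Rightarrow> real \<Rightarrow> int \<Rightarrow> bool" where
  "pre2_wd N p r \<longleftrightarrow> N \<noteq> 0 \<and> 2 * pi * of_int (nu N p + r) * of_int (int N - nu N p - r) / real N > 0"

definition coeff1 :: "nat \<Rightarrow> real \<Rightarrow> int \<Rightarrow> nat \<Rightarrow> real" where
  "coeff1 N p r k = A_tilde k (hh N p) p - Xi k p / real k * S_sum k (hh N p) r"

definition coeff2 :: "nat \<Rightarrow> real \<Rightarrow> int \<Rightarrow> nat \<Rightarrow> real" where
  "coeff2 N p r k = A_hat k (hh N p) p - Xi k p / real k * T_sum k (hh N p) r"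

text \<open>
  The coefficient \<open>C\<^sub>n\<close> of the formal series \<open>exp (\<Sum>k\<ge>1. a\<^sub>k z\<^sup>k)\<close>, with \<open>z\<close> in the role of
  \<open>1/N\<close>; the value \<open>a 0\<close> is ignored.
\<close>

definition exp_coeff :: "(nat \<Rightarrow> real) \<Rightarrow> nat \<Rightarrow> real" where
  "exp_coeff a n = fps_nth (fps_exp 1 oo Abs_fps (\<lambda>k. if k = 0 then 0 else a k)) n"

text \<open>
  The two readings of \<open>f \<sim> P exp (\<Sum>k\<ge>1. a\<^sub>k / N\<^sup>k)\<close>, uniformly for \<open>p \<in> K\<close> and \<open>\<bar>r\<bar> \<le> R\<close>.
  All of \<open>f\<close>, \<open>P\<close> and \<open>a\<close> depend on \<open>N\<close>, \<open>p\<close>, \<open>r\<close> (so the \<open>a\<^sub>k\<close> are not constants), and \<open>wd\<close>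
  says when the prefactor \<open>P\<close> is well defined, i.e. no division by zero and positive radicand.
\<close>

definition exp_expansion ::
  "real set \<Rightarrow> nat \<Rightarrow> (nat \<Rightarrow> real \<Rightarrow> int \<Rightarrow> real) \<Rightarrow> (nat \<Rightarrow> real \<Rightarrow> int \<Rightarrow> bool)
    \<Rightarrow> (nat \<Rightarrow> real \<Rightarrow> int \<Rightarrow> real) \<Rightarrow> (nat \<Rightarrow> real \<Rightarrow> int \<Rightarrow> nat \<Rightarrow> real) \<Rightarrow> bool" where
  "exp_expansion K R f wd P a \<longleftrightarrow>
     (\<forall>M. \<exists>C N0. \<forall>N\<ge>N0. \<forall>p\<in>K. \<forall>r. \<bar>r\<bar> \<le> int R \<longrightarrow>
        wd N p r \<and>
        (\<exists>\<epsilon>. f N p r = P N p r * exp (\<Sum>k=1..M. a N p r k / real N ^ k) * (1 + \<epsilon>) \<and>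
             \<bar>\<epsilon>\<bar> \<le> C / real N ^ (M + 1)))"

definition series_expansion ::
  "real set \<Rightarrow> nat \<Rightarrow> (nat \<Rightarrow> real \<Rightarrow> int \<Rightarrow> real) \<Rightarrow> (nat \<Rightarrow> real \<Rightarrow> int \<Rightarrow> bool)
    \<Rightarrow> (nat \<Rightarrow> real \<Rightarrow> int \<Rightarrow> real) \<Rightarrow> (nat \<Rightarrow> real \<Rightarrow> int \<Rightarrow> nat \<Rightarrow> real) \<Rightarrow> bool" where
  "series_expansion K R f wd P a \<longleftrightarrow>
     (\<forall>M. \<exists>C N0. \<forall>N\<ge>N0. \<forall>p\<in>K. \<forall>r. \<bar>r\<bar> \<le> int R \<longrightarrow>
        wd N p r \<and>
        (\<exists>\<epsilon>. f N p r = P N p r * ((\<Sum>n=0..M. exp_coeff (a N p r) n / real N ^ n) + \<epsilon>) \<and>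
             \<bar>\<epsilon>\<bar> \<le> C / real N ^ (M + 1)))"

end

theory Submission
  imports Defs "HOL-Real_Asymp.Real_Asymp"
begin

text \<open>
  Let \<open>F\<^sub>M(x, t) = (x + t - 1/2) ln x - x + (\<Sum>k=1..M. (-1)\<^bsup>k+1\<^esup> B\<^bsub>k+1\<^esub>(t) / (k (k+1) x\<^bsup>k\<^esup>))\<close> be the
  truncated Stirling expansion of \<open>ln \<Gamma>(x + t) - ln (2 \<pi>) / 2\<close>. The derivative of
  \<open>u \<mapsto> F\<^sub>M(y - u, u)\<close> telescopes to a single term of order \<open>y\<^bsup>-M-1\<^esup>\<close>, while
  \<open>F\<^sub>M(x, 1) - F\<^sub>M(x, 0) = ln x\<close> exactly. Together these give Stirling's formula for \<open>ln ((m - 1)!)\<close> in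
  powers of \<open>1/m\<close>, with the constant supplied by Wallis' product, and then, uniformly for bounded
  \<open>t\<close>, in powers of \<open>1/(m - t)\<close>. With \<open>m = \<nu> + r\<close> and \<open>s = m - N p = h + r\<close>, expanding
  \<open>(N - 1)!\<close>, \<open>(m - 1)!\<close>, \<open>(N - m)!\<close> in powers of \<open>1/N\<close>, \<open>1/(N p)\<close>, \<open>1/(N q)\<close> with shifts
  \<open>0\<close>, \<open>s\<close>, \<open>1 - s\<close> yields the first expansion, because \<open>B\<^sub>n(1 - s) = (-1)\<^bsup>n\<^esup> B\<^sub>n(s)\<close>. The second differs
  from it by the logarithmic series of \<open>m / (N p) = 1 + s / (N p)\<close> and
  \<open>(N - m) / (N q) = 1 - s / (N q)\<close>.
\<close>

section \<open>Bernoulli polynomials\<close>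

text \<open>The Cauchy product with \<open>fps_exp t\<close> puts all dependence on t into explicit
  powers, ready for termwise differentiation and continuity.\<close>

lemma bernpoly_eq_sum:
  "bernpoly n t = (\<Sum>i\<le>n. fact n * fps_nth (bernoulli_fps 0) i / fact (n - i) * t ^ (n - i))"
proof -
  have "bernoulli_fps t = bernoulli_fps 0 * fps_exp t"
    by (simp add: bernoulli_fps_def)
  then show ?thesis
    by (simp add: bernpoly_def fps_mult_nth sum_distrib_left atLeast0AtMost field_simps)
qed

lemma bernpoly_1: "bernpoly (Suc 0) t = t - 1 / 2"
  using bernoulli_0 bernoulli_1 by (simp add: bernoulli_def bernpoly_eq_sum)

lemma DERIV_bernpoly: "(bernpoly (Suc n) has_real_derivative real (Suc n) * bernpoly n t) (at t)"
proof -
  let ?b = "fps_nth (bernoulli_fps 0)"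
  have "((\<lambda>t. \<Sum>i\<le>Suc n. fact (Suc n) * ?b i / fact (Suc n - i) * t ^ (Suc n - i)) has_real_derivative
     (\<Sum>i\<le>Suc n. fact (Suc n) * ?b i / fact (Suc n - i) * (real (Suc n - i) * t ^ (Suc n - i - 1)))) (at t)"
    by (intro DERIV_sum DERIV_cmult) (metis DERIV_pow One_nat_def)
  \<comment> \<open>The summand \<open>i = Suc n\<close> is constant in t and drops out; in the
    others the exponent \<open>Suc d\<close> cancels against \<open>fact (Suc d)\<close>.\<close>
  moreover have "(\<Sum>i\<le>Suc n. fact (Suc n) * ?b i / fact (Suc n - i) * (real (Suc n - i) * t ^ (Suc n - i - 1)))
      = (\<Sum>i\<le>n. real (Suc n) * (fact n * ?b i / fact (n - i) * t ^ (n - i)))"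
  proof -
    have "fact (Suc n) * ?b i / fact (Suc n - i) * (real (Suc n - i) * t ^ (Suc n - i - 1))
        = real (Suc n) * (fact n * ?b i / fact (n - i) * t ^ (n - i))" if "i \<le> n" for i
    proof -
      from that obtain d where "n = i + d" using le_Suc_ex by blast
      moreover have "real (Suc d) / fact (Suc d) = 1 / fact d"
        by (simp del: of_nat_Suc)
      ultimately show ?thesis by (simp del: of_nat_Suc)
    qed
    then show ?thesis by simp
  qed
  ultimately show ?thesis
    by (simp only: bernpoly_eq_sum[abs_def] sum_distrib_left)
qed

text \<open>Real power series form an integral domain, so e^z - 1 cancels: the generating functions
  at t + 1 and t differ by exactly z e^(tz).\<close>

lemma bernpoly_add_1: "bernpoly (Suc n) (t + 1) = bernpoly (Suc n) t + real (Suc n) * t ^ n"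
proof -
  let ?E = "fps_exp 1 - 1 :: real fps"
  have "fps_nth ?E 1 \<noteq> 0" by simp
  then have ne: "?E \<noteq> 0" by (metis fps_zero_nth)
  have "(bernoulli_fps (t + 1) - bernoulli_fps t) * ?E = (fps_X * fps_exp t) * ?E"
    by (simp add: left_diff_distrib bernoulli_fps_times fps_exp_add_mult) (simp add: algebra_simps)
  with ne have "bernoulli_fps (t + 1) - bernoulli_fps t = fps_X * fps_exp t"
    by simp
  then have "bernoulli_fps (t + 1) = bernoulli_fps t + fps_X * fps_exp t"
    by (simp add: algebra_simps)
  then have "fps_nth (bernoulli_fps (t + 1)) (Suc n) = fps_nth (bernoulli_fps t) (Suc n) + t ^ n / fact n"
    by simp
  then show ?thesis by (simp add: bernpoly_def algebra_simps)
qed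

text \<open>Substituting -z in the generating function gives -z e^(-tz) / (e^(-z) - 1), and
  extending the fraction by e^z turns this into z e^((1-t)z) / (e^z - 1).\<close>

lemma bernpoly_reflect: "bernpoly n (1 - t) = (- 1) ^ n * bernpoly n t"
proof -
  let ?E = "fps_exp 1 - 1 :: real fps"
  have "fps_nth ?E 1 \<noteq> 0" by simp
  then have ne: "?E \<noteq> 0" by (metis fps_zero_nth)
  let ?X = "fps_const (- 1) * fps_X :: real fps"
  let ?C = "bernoulli_fps t oo ?X"
  have X0: "fps_nth ?X 0 = 0" by simp
  have "(bernoulli_fps t * ?E) oo ?X = (fps_X * fps_exp t) oo ?X"
    by (simp only: bernoulli_fps_times)
  then have "?C * (fps_exp (- 1) - 1) = - fps_X * fps_exp (- t)"
    unfolding fps_compose_mult_distrib[OF X0] fps_compose_sub_distrib fps_exp_compose_linear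
      fps_X_fps_compose_startby0[OF X0]
    by (simp flip: fps_const_neg)
  then have "?C * (fps_exp (- 1) - 1) * fps_exp 1 = - fps_X * (fps_exp (- t) * fps_exp 1)"
    by (simp add: mult.assoc)
  then have "?C * (1 - fps_exp 1) = - fps_X * fps_exp (1 - t)"
    by (simp add: mult.assoc left_diff_distrib flip: fps_exp_add_mult)
  then have "?C * ?E = bernoulli_fps (1 - t) * ?E"
    unfolding bernoulli_fps_times by (simp add: algebra_simps)
  with ne have C: "?C = bernoulli_fps (1 - t)" by simp
  then show ?thesis
    by (simp add: bernpoly_def fps_compose_linear flip: C del: fps_const_neg)
qed

lemma bernpoly_bounded: "\<exists>B>0. \<forall>t. \<bar>t\<bar> \<le> T \<longrightarrow> \<bar>bernpoly n t\<bar> \<le> B"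
proof -
  have "continuous_on {- T..T} (bernpoly n)"
    unfolding bernpoly_eq_sum[abs_def] by (intro continuous_intros)
  then have "bounded (bernpoly n ` {- T..T})"
    using compact_Icc compact_continuous_image compact_imp_bounded by blast
  then obtain B where "B > 0" "\<forall>x\<in>bernpoly n ` {- T..T}. norm x \<le> B"
    by (auto simp: bounded_pos)
  then show ?thesis
    by (intro exI[of _ B]) (auto simp: abs_le_iff)
qed

section \<open>The logarithmic series and the constant in Stirling's formula\<close>

text \<open>The differentiated polynomial is a finite geometric sum, so the remainder has derivative
  exactly \<open>(- x) ^ M / (1 + x)\<close>; the mean value inequality finishes, with constant 2
  because 1 + x \<ge> 1/2.\<close>

lemma ln_one_plus_truncation:
  "\<exists>C. \<forall>y::real. \<bar>y\<bar> \<le> 1 / 2 \<longrightarrow> \<bar>ln (1 + y) - (\<Sum>k=1..M. (- 1) ^ (k + 1) * y ^ k / real k)\<bar> \<le> C * \<bar>y\<bar> ^ (M + 1)"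
proof (intro exI allI impI)
  fix y :: real assume y: "\<bar>y\<bar> \<le> 1 / 2"
  define g where "g = (\<lambda>x::real. ln (1 + x) - (\<Sum>k=1..M. (- 1) ^ (k + 1) * x ^ k / real k))"
  have "norm (g y - g 0) \<le> (2 * \<bar>y\<bar> ^ M) * norm (y - 0)"
  proof (rule field_differentiable_bound[of "{- \<bar>y\<bar>..\<bar>y\<bar>}" g "\<lambda>x. (- x) ^ M / (1 + x)"])
    fix x assume x: "x \<in> {- \<bar>y\<bar>..\<bar>y\<bar>}"
    with y have x1: "\<bar>x\<bar> \<le> 1 / 2" "1 + x \<ge> 1 / 2" by auto
    have "(g has_real_derivative (1 / (1 + x) - (\<Sum>k=1..M. (- 1) ^ (k + 1) * (real k * x ^ (k - Suc 0)) / real k))) (at x)"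
      unfolding g_def using x1
      by (auto intro!: derivative_eq_intros sum.cong simp: mult_ac)
    also have "(\<Sum>k=1..M. (- 1) ^ (k + 1) * (real k * x ^ (k - Suc 0)) / real k) = (\<Sum>k<M. (- x) ^ k)"
      by (rule sum.reindex_bij_witness[of _ Suc "\<lambda>k. k - 1"]) (auto simp: power_minus[of x] Suc_le_eq gr0_conv_Suc)
    also have "1 / (1 + x) - (\<Sum>k<M. (- x) ^ k) = (- x) ^ M / (1 + x)"
      using x1 sum_gp_strict[of "- x" M] by (simp add: field_simps)
    finally show "(g has_real_derivative (- x) ^ M / (1 + x)) (at x within {- \<bar>y\<bar>..\<bar>y\<bar>})"
      by (rule has_field_derivative_at_within)
    have "\<bar>x\<bar> ^ M / (1 + x) \<le> \<bar>y\<bar> ^ M / (1 / 2)"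
      using x x1 by (intro frac_le power_mono) auto
    then show "norm ((- x) ^ M / (1 + x)) \<le> 2 * \<bar>y\<bar> ^ M"
      using x1 by (simp add: power_abs)
  qed auto
  moreover have "g 0 = 0" by (simp add: g_def power_0_left)
  ultimately show "\<bar>ln (1 + y) - (\<Sum>k=1..M. (- 1) ^ (k + 1) * y ^ k / real k)\<bar> \<le> 2 * \<bar>y\<bar> ^ (M + 1)"
    by (simp add: g_def mult.commute)
qed

section \<open>Wallis' product in factorials and Stirling's constant\<close>

lemma wallis_fact: "(\<lambda>n. 16 ^ n * fact n ^ 4 / (fact (2 * n) ^ 2 * (2 * real n + 1))) \<longlonglongrightarrow> pi / 2"
proof -
  have "(\<Prod>k=1..n. (4 * real k ^ 2) / (4 * real k ^ 2 - 1)) = 16 ^ n * fact n ^ 4 / (fact (2 * n) ^ 2 * (2 * real n + 1))"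
    for n
  proof (induction n)
    case (Suc n)
    have eq: "4 * real (Suc n) ^ 2 - 1 = (2 * real n + 1) * (2 * real n + 3)"
      by (simp add: power2_eq_square algebra_simps)
    have f: "fact (2 * Suc n) = (2 * real n + 2) * (2 * real n + 1) * fact (2 * n)" 
      by (simp add: algebra_simps)
    \<comment> \<open>With opaque names for the factorials and linear factors the induction step
      becomes an identity of rational functions.\<close>
    define F G u a b :: real
      where "F = fact (2 * n)" and "G = fact n" and "u = real (Suc n)" and "a = 2 * real n + 1" and "b = 2 * real n + 3"
    have e: "2 * real n + 2 = 2 * u" "2 * real (Suc n) + 1 = b"
      by (auto simp: u_def b_def)
    have [simp]: "F \<noteq> 0" "a \<noteq> 0" "b \<noteq> 0" "u \<noteq> 0"
      by (auto simp: F_def a_def b_def u_def)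
    have "(\<Prod>k=1..Suc n. (4 * real k ^ 2) / (4 * real k ^ 2 - 1))
        = 16 ^ n * G ^ 4 / (F ^ 2 * a) * (4 * u ^ 2 / (a * b))"
      using Suc.IH eq by (simp add: F_def G_def u_def a_def b_def)
    also have "\<dots> = 16 ^ Suc n * (u * G) ^ 4 / ((2 * u * a * F) ^ 2 * b)"
      by (simp add: field_simps eval_nat_numeral)
    also have "\<dots> = 16 ^ Suc n * fact (Suc n) ^ 4 / (fact (2 * Suc n) ^ 2 * (2 * real (Suc n) + 1))"
      unfolding f e fact_Suc by (simp add: F_def G_def u_def a_def)
    finally show ?case .
  qed simp
  with wallis show ?thesis by simp
qed

text \<open>Convergence is assumed here and supplied by telescoping in
  \<open>ln_fact_stirling\<close>. Four times the n-th term minus twice the 2n-th is the logarithm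
  of Wallis' expression up to an elementary term with limit ln(1/4), whence 2c + ln(1/4) =
  ln(pi/2).\<close>

lemma stirling_constant:
  assumes "(\<lambda>n. ln (fact n) - (real n + 1 / 2) * ln (real n) + real n) \<longlonglongrightarrow> c"
  shows "c = ln (2 * pi) / 2"
proof -
  let ?d = "\<lambda>n::nat. ln (fact n) - (real n + 1 / 2) * ln (real n) + real n :: real"
  let ?w = "\<lambda>n. 16 ^ n * fact n ^ 4 / (fact (2 * n) ^ 2 * (2 * real n + 1)) :: real"
  have "filterlim (\<lambda>n::nat. 2 * n) at_top at_top"
    by (intro filterlim_subseq) (auto simp: strict_mono_def)
  then have "(\<lambda>n. ?d (2 * n)) \<longlonglongrightarrow> c"
    using assms by (rule filterlim_compose[rotated])
  then have "(\<lambda>n. 4 * ?d n - 2 * ?d (2 * n)) \<longlonglongrightarrow> 4 * c - 2 * c"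
    using assms by (intro tendsto_intros)
  moreover have "(\<lambda>n. ln (real n / (2 * (2 * real n + 1)))) \<longlonglongrightarrow> ln (1 / 4)"
    by real_asymp
  ultimately have "(\<lambda>n. 4 * ?d n - 2 * ?d (2 * n) + ln (real n / (2 * (2 * real n + 1)))) \<longlonglongrightarrow> 4 * c - 2 * c + ln (1 / 4)"
    by (rule tendsto_add)
  moreover have "eventually (\<lambda>n. 4 * ?d n - 2 * ?d (2 * n) + ln (real n / (2 * (2 * real n + 1))) = ln (?w n)) at_top"
    using eventually_gt_at_top[of 0]
  proof eventually_elim
    case (elim n)
    have w: "ln (?w n) = real n * (4 * ln 2) + 4 * ln (fact n) - 2 * ln (fact (2 * n)) - ln (2 * real n + 1)"
      using ln_realpow[of 2 4] by (simp add: ln_div ln_mult ln_realpow)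
    have l: "ln (real n / (2 * (2 * real n + 1))) = ln (real n) - ln 2 - ln (2 * real n + 1)"
      using elim by (simp add: ln_divide_pos ln_mult_pos del: distrib_left_numeral)
    have "ln (real (2 * n)) = ln 2 + ln (real n)"
      using elim by (simp add: ln_mult)
    then show ?case unfolding w l by (simp add: algebra_simps)
  qed
  ultimately have "(\<lambda>n. ln (?w n)) \<longlonglongrightarrow> 4 * c - 2 * c + ln (1 / 4)"
    by (rule Lim_transform_eventually)
  moreover have "(\<lambda>n. ln (?w n)) \<longlonglongrightarrow> ln (pi / 2)"
    by (intro tendsto_ln wallis_fact) auto
  ultimately have "4 * c - 2 * c + ln (1 / 4) = ln (pi / 2)"
    by (rule LIMSEQ_unique)
  then show ?thesis
    using ln_realpow[of 2 2] by (simp add: ln_div ln_mult)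
qed

text \<open>Summing the increments from m onwards costs one power of m.\<close>

lemma telescoping_limit:
  fixes E :: "nat \<Rightarrow> real"
  assumes E: "\<And>i. i \<ge> 1 \<Longrightarrow> \<bar>E (Suc i) - E i\<bar> \<le> C / real i ^ (M + 2)"
  shows "\<exists>L. E \<longlonglongrightarrow> L \<and> (\<forall>m\<ge>1. \<bar>E m - L\<bar> \<le> 2 * C / real m ^ (M + 1))"
proof -
  have C: "C \<ge> 0" using E[of 1] by simp
  \<comment> \<open>The factor 1/m - 1/n telescopes, so induction on n closes; the 2 comes from n^2
    \<ge> n(n+1)/2.\<close>
  have bd: "\<bar>E n - E m\<bar> \<le> 2 * C / real m ^ M * (1 / real m - 1 / real n)" if "1 \<le> m" "m \<le> n" for m n
    using that(2)
  proof (induction n rule: dec_induct)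
    case (step n)
    with that(1) have n: "n \<ge> 1" by simp
    have "\<bar>E (Suc n) - E n\<bar> \<le> C / (real n ^ M * real n ^ 2)"
      using E[OF n] by (simp add: power_add power2_eq_square mult_ac)
    also have "\<dots> \<le> C / (real m ^ M * (real n * real (Suc n) / 2))"
      using n step that C
      by (intro divide_left_mono mult_mono mult_pos_pos power_mono) (auto simp: power2_eq_square)
    also have "\<dots> = 2 * C / real m ^ M * (1 / real n - 1 / real (Suc n))"
      using n that by (simp add: field_simps)
    finally show ?case using step.IH by (simp add: right_diff_distrib)
  qed simp
  have bd2: "\<bar>E n - E m\<bar> \<le> 2 * C / real m ^ (M + 1)" if "1 \<le> m" "m \<le> n" for m n
  proof -
    have "2 * C / real m ^ M * (1 / real m - 1 / real n) \<le> 2 * C / real m ^ M * (1 / real m)"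
      using C by (intro mult_left_mono) auto
    with bd[OF that] show ?thesis by (simp add: mult.commute)
  qed
  have "Cauchy E"
  proof (rule metric_CauchyI)
    fix e :: real assume "e > 0"
    have "(\<lambda>m. 2 * C / real m ^ (M + 1)) \<longlonglongrightarrow> 0"
      by real_asymp
    then have "eventually (\<lambda>m. 2 * C / real m ^ (M + 1) < e / 2) at_top"
      using \<open>e > 0\<close> by (intro order_tendstoD(2)) auto
    then have "eventually (\<lambda>m. 2 * C / real m ^ (M + 1) < e / 2 \<and> m \<ge> 1) at_top"
      by (intro eventually_conj eventually_ge_at_top)
    then obtain m where m: "2 * C / real m ^ (M + 1) < e / 2" "m \<ge> 1"
      by (auto simp: eventually_at_top_linorder)
    show "\<exists>m. \<forall>i\<ge>m. \<forall>n\<ge>m. dist (E i) (E n) < e"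
    proof (intro exI allI impI)
      fix i n assume "i \<ge> m" "n \<ge> m"
      with bd2[OF m(2)] m(1) have "\<bar>E i - E m\<bar> < e / 2" "\<bar>E n - E m\<bar> < e / 2" by fastforce+
      then show "dist (E i) (E n) < e" unfolding dist_real_def by linarith
    qed
  qed
  then obtain L where L: "E \<longlonglongrightarrow> L"
    by (auto simp: Cauchy_convergent_iff convergent_def)
  have "\<bar>E m - L\<bar> \<le> 2 * C / real m ^ (M + 1)" if "m \<ge> 1" for m
  proof -
    have "(\<lambda>n. \<bar>E n - E m\<bar>) \<longlonglongrightarrow> \<bar>L - E m\<bar>"
      using L by (intro tendsto_intros)
    then have "\<bar>L - E m\<bar> \<le> 2 * C / real m ^ (M + 1)"
      by (rule tendsto_upperbound) (use bd2[OF that] in \<open>auto simp: eventually_at_top_linorder\<close>)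
    then show ?thesis by (simp add: abs_minus_commute)
  qed
  with L show ?thesis by blast
qed

section \<open>Stirling's expansion with a shift\<close>

text \<open>For \<open>x + t = m\<close> this approximates \<open>ln (fact (m - 1))\<close> up to
  the constant \<open>ln (2 * pi) / 2\<close>.\<close>

definition stirling_main :: "nat \<Rightarrow> real \<Rightarrow> real \<Rightarrow> real" where
  "stirling_main M x t = (x + t - 1 / 2) * ln x - x
     + (\<Sum>k=1..M. (- 1) ^ (k + 1) * bernpoly (k + 1) t / (real k * real (k + 1) * x ^ k))"

lemma stirling_main_Suc:
  "stirling_main (Suc M) x t = stirling_main M x t
     + (- 1) ^ M * bernpoly (M + 2) t / (real (M + 1) * real (M + 2) * x ^ (M + 1))"
  by (simp add: stirling_main_def)

text \<open>Induction on M: by the quotient rule the added term contributes two summands. The one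
  with \<open>bernpoly (M + 1)\<close> cancels the derivative left at the previous order, and the
  one with \<open>bernpoly (M + 2)\<close> is the new derivative.\<close>

lemma DERIV_stirling_main:
  assumes "u < y"
  shows "((\<lambda>u. stirling_main M (y - u) u) has_real_derivative
     (- 1) ^ (M + 1) * bernpoly (M + 1) u / (real (M + 1) * (y - u) ^ (M + 1))) (at u)"
proof (induction M)
  \<comment> \<open>Along \<open>x = y - u\<close>, \<open>t = u\<close> the factor of the logarithm
    is the constant y - 1/2, so the derivative is 1 - (y - 1/2)/(y - u) = -(u - 1/2)/(y -
    u).\<close>
  case 0
  show ?case using assms unfolding stirling_main_def
    by (auto intro!: derivative_eq_intros simp: bernpoly_1 field_simps)
next
  case (Suc M)
  define x where "x = y - u"
  have x: "x > 0" using assms by (simp add: x_def)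
  have e: "M + 2 = Suc (M + 1)" by simp
  have d: "((\<lambda>u. bernpoly (M + 2) u) has_real_derivative real (M + 2) * bernpoly (M + 1) u) (at u)"
    using DERIV_bernpoly[of "M + 1" u] unfolding e .
  have "((\<lambda>u. (y - u) ^ (M + 1)) has_real_derivative - (real (M + 1) * x ^ M)) (at u)"
  proof -
    have "((\<lambda>u. y - u) has_real_derivative - 1) (at u)"
      by (auto intro!: derivative_eq_intros)
    from DERIV_power_Suc[OF this, of M] show ?thesis by (simp add: x_def)
  qed
  from DERIV_divide[OF d this] x
  have "((\<lambda>u. bernpoly (M + 2) u / (y - u) ^ (M + 1)) has_real_derivative
     (real (M + 2) * bernpoly (M + 1) u * x ^ (M + 1) + bernpoly (M + 2) u * (real (M + 1) * x ^ M))
       / (x ^ (M + 1) * x ^ (M + 1))) (at u)"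
    by (simp add: x_def)
  also have "(real (M + 2) * bernpoly (M + 1) u * x ^ (M + 1) + bernpoly (M + 2) u * (real (M + 1) * x ^ M))
       / (x ^ (M + 1) * x ^ (M + 1))
     = real (M + 2) * bernpoly (M + 1) u / x ^ (M + 1) + real (M + 1) * bernpoly (M + 2) u / x ^ (M + 2)"
  proof -
    have "(b * P * (x * X) + Q * (a * X)) / ((x * X) * (x * X)) = b * P / (x * X) + a * Q / (x * (x * X))"
      if "X \<noteq> 0" for a b P Q X :: real
      using that x by (simp add: field_simps)
    from this[of "x ^ M"] x show ?thesis by (simp only: e power_Suc Suc_eq_plus1[symmetric]) simp
  qed
  finally have "((\<lambda>u. bernpoly (M + 2) u / (y - u) ^ (M + 1)) has_real_derivative
     (real (M + 2) * bernpoly (M + 1) u / x ^ (M + 1) + real (M + 1) * bernpoly (M + 2) u / x ^ (M + 2))) (at u)" .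
  from DERIV_cmult[OF this, of "(- 1) ^ M / (real (M + 1) * real (M + 2))"]
  have "((\<lambda>u. (- 1) ^ M * bernpoly (M + 2) u / (real (M + 1) * real (M + 2) * (y - u) ^ (M + 1))) has_real_derivative
     (- 1) ^ M / (real (M + 1) * real (M + 2)) *
     (real (M + 2) * bernpoly (M + 1) u / x ^ (M + 1) + real (M + 1) * bernpoly (M + 2) u / x ^ (M + 2))) (at u)"
    by simp
  from DERIV_add[OF Suc.IH this] have "((\<lambda>u. stirling_main (Suc M) (y - u) u) has_real_derivative
     ((- 1) ^ (M + 1) * bernpoly (M + 1) u / (real (M + 1) * x ^ (M + 1)) +
     (- 1) ^ M / (real (M + 1) * real (M + 2)) *
     (real (M + 2) * bernpoly (M + 1) u / x ^ (M + 1) + real (M + 1) * bernpoly (M + 2) u / x ^ (M + 2)))) (at u)"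
    by (simp only: stirling_main_Suc x_def)
  also have "((- 1) ^ (M + 1) * bernpoly (M + 1) u / (real (M + 1) * x ^ (M + 1)) +
     (- 1) ^ M / (real (M + 1) * real (M + 2)) *
     (real (M + 2) * bernpoly (M + 1) u / x ^ (M + 1) + real (M + 1) * bernpoly (M + 2) u / x ^ (M + 2)))
     = (- 1) ^ M * bernpoly (M + 2) u / (real (M + 2) * x ^ (M + 2))"
  proof -
    define a b X P Q :: real where "a = real (M + 1)" and "b = real (M + 2)" and "X = x ^ (M + 1)"
      and "P = bernpoly (M + 1) u" and "Q = bernpoly (M + 2) u"
    have nz: "a \<noteq> 0" "b \<noteq> 0" "X \<noteq> 0" "x \<noteq> 0"
      using x by (auto simp: a_def b_def X_def)
    have X2: "x ^ (M + 2) = x * X" by (simp add: X_def)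
    have "- s * P / (a * X) + s / (a * b) * (b * P / X + a * Q / (x * X)) = s * Q / (b * (x * X))" for s
      using nz by (simp add: field_simps)
    from this[of "(- 1) ^ M"] have "(- 1) ^ (M + 1) * P / (a * X) + (- 1) ^ M / (a * b) * (b * P / X + a * Q / (x * X))
        = (- 1) ^ M * Q / (b * (x * X))" by simp
    then show ?thesis
      by (simp only: a_def b_def P_def Q_def X2 X_def)
  qed
  finally show ?case by (simp add: x_def)
qed

text \<open>Mean value inequality on [-T, T]. The condition y \<ge> 2T keeps y - z \<ge> y/2, which
  puts \<open>2 ^ (M + 1)\<close> into the constant; its factor \<open>2 * T\<close> bounds the
  distance of t and u.\<close>

lemma stirling_main_shift_bound:
  assumes "T > 0"
  shows "\<exists>C. \<forall>y t u. 2 * T \<le> y \<and> \<bar>t\<bar> \<le> T \<and> \<bar>u\<bar> \<le> T \<longrightarrow>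
     \<bar>stirling_main M (y - t) t - stirling_main M (y - u) u\<bar> \<le> C / y ^ (M + 1)"
proof -
  obtain B where B: "B > 0" "\<And>t. \<bar>t\<bar> \<le> T \<Longrightarrow> \<bar>bernpoly (M + 1) t\<bar> \<le> B"
    using bernpoly_bounded[of T "M + 1"] by auto
  show ?thesis
  proof (intro exI allI impI, elim conjE)
    fix y t u assume y: "2 * T \<le> y" and t: "\<bar>t\<bar> \<le> T" and u: "\<bar>u\<bar> \<le> T"
    let ?g = "\<lambda>u. stirling_main M (y - u) u"
    let ?D = "B / (y / 2) ^ (M + 1)"
    have "norm (?g t - ?g u) \<le> ?D * norm (t - u)"
    proof (rule field_differentiable_bound[of "{- T..T}" ?g
          "\<lambda>u. (- 1) ^ (M + 1) * bernpoly (M + 1) u / (real (M + 1) * (y - u) ^ (M + 1))"])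
      fix z assume z: "z \<in> {- T..T}"
      with y assms have yz: "y / 2 \<le> y - z" "y > 0" by auto
      then have "z < y" by simp
      then show "(?g has_real_derivative
         (- 1) ^ (M + 1) * bernpoly (M + 1) z / (real (M + 1) * (y - z) ^ (M + 1))) (at z within {- T..T})"
        by (rule has_field_derivative_at_within[OF DERIV_stirling_main])
      have "\<bar>bernpoly (M + 1) z\<bar> / (real (M + 1) * (y - z) ^ (M + 1)) \<le> B / (1 * (y / 2) ^ (M + 1))"
      proof (rule frac_le)
        show "\<bar>bernpoly (M + 1) z\<bar> \<le> B" using z by (intro B) auto
        show "1 * (y / 2) ^ (M + 1) \<le> real (M + 1) * (y - z) ^ (M + 1)"
          using yz by (intro mult_mono power_mono) auto
      qed (use B yz in auto)
      then show "norm ((- 1) ^ (M + 1) * bernpoly (M + 1) z / (real (M + 1) * (y - z) ^ (M + 1))) \<le> ?D"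
        using yz by (simp add: abs_mult power_abs)
    qed (use t u in auto)
    also have "\<dots> \<le> ?D * (2 * T)"
      using t u y assms B by (intro mult_left_mono) auto
    finally show "\<bar>?g t - ?g u\<bar> \<le> (B * 2 ^ (M + 1) * (2 * T)) / y ^ (M + 1)"
      by (simp add: power_divide mult_ac)
  qed
qed

text \<open>The exact counterpart of Gamma(x + 1) = x Gamma(x) for the truncated expansion.\<close>

lemma stirling_main_1: "stirling_main M x 1 = stirling_main M x 0 + ln x"
proof -
  \<comment> \<open>For k \<ge> 1 the difference is a multiple of \<open>0 ^ k\<close>, so only the
    factor of the logarithm changes.\<close>
  have "bernpoly (k + 1) 1 = bernpoly (k + 1) 0" if "k \<ge> 1" for k
    using bernpoly_add_1[of k 0] that by simp
  then have "(\<Sum>k=1..M. (- 1) ^ (k + 1) * bernpoly (k + 1) 1 / (real k * real (k + 1) * x ^ k))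
      = (\<Sum>k=1..M. (- 1) ^ (k + 1) * bernpoly (k + 1) 0 / (real k * real (k + 1) * x ^ k))"
    by (intro sum.cong refl) auto
  then show ?thesis unfolding stirling_main_def by (simp only:) (simp add: field_simps)
qed

lemma ln_fact_stirling:
  "\<exists>C. \<forall>m\<ge>1. \<bar>ln (fact (m - 1)) - stirling_main M (real m) 0 - ln (2 * pi) / 2\<bar> \<le> C / real m ^ (M + 1)"
proof -
  \<comment> \<open>Order \<open>Suc M\<close> compensates for the power lost in summation:
    increments of order i^(-M-2) leave an error of order m^(-M-1).\<close>
  define E where "E = (\<lambda>m. ln (fact (m - 1)) - stirling_main (Suc M) (real m) 0)"
  define c where "c = (\<lambda>k. (- 1) ^ (k + 1) * bernpoly (k + 1) 0 / (real k * real (k + 1)))"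
  obtain C where C: "\<And>y t u. 2 * (1::real) \<le> y \<and> \<bar>t\<bar> \<le> 1 \<and> \<bar>u\<bar> \<le> 1 \<Longrightarrow>
     \<bar>stirling_main (Suc M) (y - t) t - stirling_main (Suc M) (y - u) u\<bar> \<le> C / y ^ (Suc M + 1)"
    using stirling_main_shift_bound[of 1 "Suc M"] by auto
  have C0: "C \<ge> 0"
  proof (rule ccontr)
    assume "\<not> C \<ge> 0"
    then have "C / 2 ^ (Suc M + 1) < 0" by (intro divide_neg_pos) auto
    with C[of 2 1 1] show False by simp
  qed
  have "\<bar>E (Suc i) - E i\<bar> \<le> C / real i ^ (M + 2)" if "i \<ge> 1" for i
  proof -
    have "fact i = real i * fact (i - 1)" using that by (simp add: fact_reduce)
    then have "ln (fact i) = ln (real i) + ln (fact (i - 1))" using that by (simp add: ln_mult)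
    \<comment> \<open>By \<open>stirling_main_1\<close> the increment compares two points with the
      same sum \<open>x + t = i + 1\<close>, to which the shift bound applies.\<close>
    then have "E (Suc i) - E i = stirling_main (Suc M) (real i) 1 - stirling_main (Suc M) (real i + 1) 0"
      by (simp add: E_def stirling_main_1 add.commute)
    moreover have "\<bar>stirling_main (Suc M) (real i) 1 - stirling_main (Suc M) (real i + 1) 0\<bar> \<le> C / (real i + 1) ^ (M + 2)"
      using C[of "real i + 1" 1 0] that by simp
    moreover have "C / (real i + 1) ^ (M + 2) \<le> C / real i ^ (M + 2)"
      using C0 that by (intro divide_left_mono power_mono mult_pos_pos) auto
    ultimately show ?thesis by linarith
  qed
  from telescoping_limit[OF this] obtain L where L: "E \<longlonglongrightarrow> L"
    and EL: "\<And>m. m \<ge> 1 \<Longrightarrow> \<bar>E m - L\<bar> \<le> 2 * C / real m ^ (M + 1)" by blast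
  \<comment> \<open>Adding back the correction terms, which tend to 0, turns E into the sequence of
    \<open>stirling_constant\<close> without changing the limit.\<close>
  have "(\<lambda>n. E n + (\<Sum>k=1..Suc M. c k * (1 / real n ^ k))) \<longlonglongrightarrow> L + (\<Sum>k=1..Suc M. c k * 0)"
  proof (intro tendsto_intros L)
    fix k assume "k \<in> {1..Suc M}"
    then have "k > 0" by simp
    then show "(\<lambda>n. 1 / real n ^ k) \<longlonglongrightarrow> 0"
      by (intro tendsto_divide_0[OF tendsto_const] filterlim_at_top_imp_at_infinity filterlim_pow_at_top filterlim_real_sequentially)
  qed
  then have "(\<lambda>n. E n + (\<Sum>k=1..Suc M. c k * (1 / real n ^ k))) \<longlonglongrightarrow> L" by simp
  moreover have "eventually (\<lambda>n. E n + (\<Sum>k=1..Suc M. c k * (1 / real n ^ k))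
      = ln (fact n) - (real n + 1 / 2) * ln (real n) + real n) at_top"
    using eventually_ge_at_top[of 1]
  proof eventually_elim
    case (elim n)
    have "fact n = real n * fact (n - 1)" using elim by (simp add: fact_reduce)
    then have "ln (fact n) = ln (real n) + ln (fact (n - 1))" using elim by (simp add: ln_mult)
    then show ?case
      unfolding E_def stirling_main_def c_def by (simp add: algebra_simps del: sum.cl_ivl_Suc)
  qed
  ultimately have "(\<lambda>n. ln (fact n) - (real n + 1 / 2) * ln (real n) + real n) \<longlonglongrightarrow> L"
    by (rule Lim_transform_eventually)
  then have Leq: "L = ln (2 * pi) / 2" by (rule stirling_constant)
  show ?thesis
  proof (intro exI allI impI)
    fix m :: nat assume m: "m \<ge> 1"
    \<comment> \<open>Returning to order M costs the top term, which is itself of the permitted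
      order.\<close>
    have "stirling_main (Suc M) (real m) 0 - stirling_main M (real m) 0 = c (M + 1) / real m ^ (M + 1)"
      by (simp add: stirling_main_Suc c_def)
    then have "\<bar>stirling_main (Suc M) (real m) 0 - stirling_main M (real m) 0\<bar> = \<bar>c (M + 1)\<bar> / real m ^ (M + 1)"
      using m by (simp add: abs_mult)
    with EL[OF m] show "\<bar>ln (fact (m - 1)) - stirling_main M (real m) 0 - ln (2 * pi) / 2\<bar>
        \<le> (2 * C + \<bar>c (M + 1)\<bar>) / real m ^ (M + 1)"
      unfolding E_def Leq add_divide_distrib by linarith
  qed
qed

text \<open>Moving from shift 0 to shift t with \<open>x + t = m\<close> fixed costs only order
  m^(-M-1).\<close>

lemma ln_fact_stirling_shifted:
  assumes "T > 0"
  shows "\<exists>C. \<forall>m t. 1 \<le> m \<and> 2 * T \<le> real m \<and> \<bar>t\<bar> \<le> T \<longrightarrow>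
     \<bar>ln (fact (m - 1)) - stirling_main M (real m - t) t - ln (2 * pi) / 2\<bar> \<le> C / real m ^ (M + 1)"
proof -
  obtain C1 where C1: "\<And>m. m \<ge> 1 \<Longrightarrow>
      \<bar>ln (fact (m - 1)) - stirling_main M (real m) 0 - ln (2 * pi) / 2\<bar> \<le> C1 / real m ^ (M + 1)"
    using ln_fact_stirling by blast
  obtain C2 where C2: "\<forall>y t u. 2 * T \<le> y \<and> \<bar>t\<bar> \<le> T \<and> \<bar>u\<bar> \<le> T \<longrightarrow>
     \<bar>stirling_main M (y - t) t - stirling_main M (y - u) u\<bar> \<le> C2 / y ^ (M + 1)"
    using stirling_main_shift_bound[OF assms, of M] ..
  show ?thesis
  proof (intro exI allI impI, elim conjE)
    fix m t assume m: "1 \<le> m" "2 * T \<le> real m" "\<bar>t\<bar> \<le> T"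
    have "\<bar>stirling_main M (real m - t) t - stirling_main M (real m) 0\<bar> \<le> C2 / real m ^ (M + 1)"
      using C2[rule_format, of "real m" t 0] m assms by simp
    with C1[OF m(1)] show "\<bar>ln (fact (m - 1)) - stirling_main M (real m - t) t - ln (2 * pi) / 2\<bar>
        \<le> (C1 + C2) / real m ^ (M + 1)"
      unfolding add_divide_distrib by linarith
  qed
qed

section \<open>The exponential of a power series\<close>

lemma exp_coeff_0: "exp_coeff a 0 = 1"
  by (simp add: exp_coeff_def)

text \<open>Coefficient comparison in F' = F A' for F = exp(A). Together with C_0 = 1 this
  recurrence is all that is used of the composition.\<close>

lemma exp_coeff_Suc:
  "real (Suc n) * exp_coeff a (Suc n) = (\<Sum>i\<le>n. exp_coeff a i * (real (Suc (n - i)) * a (Suc (n - i))))"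
proof -
  define A where "A = Abs_fps (\<lambda>k. if k = 0 then 0 else a k)"
  define F where "F = fps_exp 1 oo A"
  have "fps_deriv F = F * fps_deriv A"
    unfolding F_def by (subst fps_compose_deriv) (auto simp: A_def)
  then have "fps_nth (fps_deriv F) n = fps_nth (F * fps_deriv A) n" by simp
  then have "real (Suc n) * fps_nth F (Suc n)
      = (\<Sum>i\<le>n. fps_nth F i * (real (Suc (n - i)) * fps_nth A (Suc (n - i))))"
    by (simp add: fps_mult_nth atLeast0AtMost)
  then show ?thesis by (simp add: F_def A_def exp_coeff_def)
qed

text \<open>An exponent function m encodes a monomial by its values at 1, ..., n. Functions that
  differ only elsewhere name the same monomial, and their contributions add.\<close>

definition polynomial_in :: "nat \<Rightarrow> ((nat \<Rightarrow> real) \<Rightarrow> real) \<Rightarrow> bool" where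
  "polynomial_in n f \<longleftrightarrow> (\<exists>(F :: (nat \<Rightarrow> nat) set) c. finite F \<and>
     (\<forall>a. f a = (\<Sum>m\<in>F. c m * (\<Prod>k=1..n. a k ^ m k))))"

lemma polynomial_in_const: "polynomial_in n (\<lambda>a. c)"
  unfolding polynomial_in_def by (intro exI[of _ "{\<lambda>_. 0}"] exI[of _ "\<lambda>_. c"]) auto

lemma polynomial_in_add:
  assumes "polynomial_in n f" "polynomial_in n g"
  shows "polynomial_in n (\<lambda>a. f a + g a)"
proof -
  obtain F c where F: "finite F" "\<And>a. f a = (\<Sum>m\<in>F. c m * (\<Prod>k=1..n. a k ^ m k))"
    using assms(1) unfolding polynomial_in_def by blast
  obtain G d where G: "finite G" "\<And>a. g a = (\<Sum>m\<in>G. d m * (\<Prod>k=1..n. a k ^ m k))"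
    using assms(2) unfolding polynomial_in_def by blast
  let ?e = "\<lambda>m. (if m \<in> F then c m else 0) + (if m \<in> G then d m else 0)"
  have "f a + g a = (\<Sum>m\<in>F \<union> G. ?e m * (\<Prod>k=1..n. a k ^ m k))" for a
  proof -
    have "f a = (\<Sum>m\<in>F \<union> G. (if m \<in> F then c m else 0) * (\<Prod>k=1..n. a k ^ m k))"
      unfolding F(2) using F(1) G(1) by (intro sum.mono_neutral_cong_left) auto
    moreover have "g a = (\<Sum>m\<in>F \<union> G. (if m \<in> G then d m else 0) * (\<Prod>k=1..n. a k ^ m k))"
      unfolding G(2) using F(1) G(1) by (intro sum.mono_neutral_cong_left) auto
    ultimately show ?thesis by (simp add: sum.distrib distrib_right)
  qed
  then show ?thesis
    unfolding polynomial_in_def using F(1) G(1) by (intro exI[of _ "F \<union> G"] exI[of _ ?e]) simp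
qed

lemma polynomial_in_sum:
  "finite I \<Longrightarrow> (\<And>i. i \<in> I \<Longrightarrow> polynomial_in n (f i)) \<Longrightarrow> polynomial_in n (\<lambda>a. \<Sum>i\<in>I. f i a)"
  by (induction I rule: finite_induct) (auto intro: polynomial_in_const polynomial_in_add)

lemma polynomial_in_cmult_var:
  assumes "polynomial_in n f" "j \<in> {1..n}"
  shows "polynomial_in n (\<lambda>a. f a * (x * a j))"
proof -
  obtain F c where F: "finite F" "\<And>a. f a = (\<Sum>m\<in>F. c m * (\<Prod>k=1..n. a k ^ m k))"
    using assms(1) unfolding polynomial_in_def by blast
  \<comment> \<open>\<open>up\<close> multiplies a monomial by the j-th variable. Its left inverse
    \<open>down\<close> gives injectivity for the reindexing and carries the coefficients to the
    image.\<close>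
  define up :: "(nat \<Rightarrow> nat) \<Rightarrow> nat \<Rightarrow> nat" where "up = (\<lambda>m. m(j := Suc (m j)))"
  define down :: "(nat \<Rightarrow> nat) \<Rightarrow> nat \<Rightarrow> nat" where "down = (\<lambda>m. m(j := m j - 1))"
  have du: "down (up m) = m" for m by (auto simp: up_def down_def)
  then have inj: "inj_on up F" by (metis inj_on_inverseI)
  have up: "(\<Prod>k=1..n. a k ^ up m k) = (\<Prod>k=1..n. a k ^ m k) * a j" for a :: "nat \<Rightarrow> real" and m
  proof -
    have "(\<Prod>k=1..n. a k ^ up m k) = (\<Prod>k=1..n. a k ^ m k * (if k = j then a j else 1))"
      by (intro prod.cong) (auto simp: up_def)
    also have "\<dots> = (\<Prod>k=1..n. a k ^ m k) * a j"
      using assms(2) by (simp add: prod.distrib)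
    finally show ?thesis .
  qed
  have "f a * (x * a j) = (\<Sum>m\<in>up ` F. (x * c (down m)) * (\<Prod>k=1..n. a k ^ m k))" for a
    by (simp add: F(2) sum.reindex[OF inj] du up sum_distrib_right sum_distrib_left mult_ac del: One_nat_def)
  then show ?thesis
    unfolding polynomial_in_def using F(1) by (intro exI[of _ "up ` F"] exI[of _ "\<lambda>m. x * c (down m)"]) simp
qed

text \<open>Strong induction through the recurrence. The number n of variables stays fixed while i
  varies, so all summands lie in one class closed under the operations above.\<close>

lemma polynomial_in_exp_coeff: "i \<le> n \<Longrightarrow> polynomial_in n (\<lambda>a. exp_coeff a i)"
proof (induction i rule: less_induct)
  case (less i)
  show ?case
  proof (cases i)
    case 0
    then show ?thesis by (simp add: exp_coeff_0 polynomial_in_const)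
  next
    case (Suc l)
    have "exp_coeff a i = (\<Sum>j\<le>l. exp_coeff a j * (real (Suc (l - j)) / real (Suc l) * a (Suc (l - j))))" for a
      using exp_coeff_Suc[of l a] unfolding Suc
      by (simp add: field_simps sum_divide_distrib[symmetric] del: of_nat_Suc)
    moreover have "polynomial_in n
        (\<lambda>a. \<Sum>j\<le>l. exp_coeff a j * (real (Suc (l - j)) / real (Suc l) * a (Suc (l - j))))"
      using less.prems Suc by (intro polynomial_in_sum polynomial_in_cmult_var less.IH) auto
    ultimately show ?thesis by simp
  qed
qed

lemma polynomial_in_bounded:
  assumes "polynomial_in n f" "A \<ge> 0"
  shows "\<exists>B. \<forall>a. (\<forall>k\<in>{1..n}. \<bar>a k\<bar> \<le> A) \<longrightarrow> \<bar>f a\<bar> \<le> B"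
proof -
  obtain F c where F: "finite F" "\<And>a. f a = (\<Sum>m\<in>F. c m * (\<Prod>k=1..n. a k ^ m k))"
    using assms(1) unfolding polynomial_in_def by blast
  have "\<bar>f a\<bar> \<le> (\<Sum>m\<in>F. \<bar>c m\<bar> * (\<Prod>k=1..n. A ^ m k))" if "\<forall>k\<in>{1..n}. \<bar>a k\<bar> \<le> A" for a
  proof -
    have "\<bar>f a\<bar> \<le> (\<Sum>m\<in>F. \<bar>c m * (\<Prod>k=1..n. a k ^ m k)\<bar>)"
      unfolding F(2) by (rule sum_abs)
    also have "\<dots> \<le> (\<Sum>m\<in>F. \<bar>c m\<bar> * (\<Prod>k=1..n. A ^ m k))"
      using that by (intro sum_mono) (auto simp: abs_mult abs_prod power_abs intro!: mult_left_mono prod_mono power_mono)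
    finally show ?thesis .
  qed
  then show ?thesis by blast
qed

text \<open>The truncation \<open>y\<close> of the series solves \<open>y' = P' y\<close> up to terms of order \<open>z\<^sup>M\<close>, so that
  \<open>y exp (- P)\<close> has derivative of that order.\<close>

lemma exp_coeff_truncation:
  assumes "A \<ge> 0"
  shows "\<exists>C. \<forall>a z. (\<forall>k\<in>{1..M}. \<bar>a k\<bar> \<le> A) \<and> 0 \<le> z \<and> z \<le> 1 \<longrightarrow>
     \<bar>exp (\<Sum>k=1..M. a k * z ^ k) - (\<Sum>n\<le>M. exp_coeff a n * z ^ n)\<bar> \<le> C * z ^ (M + 1)"
proof -
  \<comment> \<open>One B has to serve every sequence bounded by A; this is where the polynomial
    form of the coefficients enters.\<close>
  have "\<exists>B. \<forall>a. (\<forall>k\<in>{1..M}. \<bar>a k\<bar> \<le> A) \<longrightarrow> \<bar>\<Sum>n\<le>M. \<bar>exp_coeff a n\<bar>\<bar> \<le> B"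
  proof -
    have "\<exists>B. \<forall>a. (\<forall>k\<in>{1..M}. \<bar>a k\<bar> \<le> A) \<longrightarrow> \<bar>exp_coeff a n\<bar> \<le> B" if "n \<le> M" for n
      using polynomial_in_bounded[OF polynomial_in_exp_coeff[OF that] assms] .
    then obtain B where B: "\<And>n a. n \<le> M \<Longrightarrow> (\<forall>k\<in>{1..M}. \<bar>a k\<bar> \<le> A) \<Longrightarrow> \<bar>exp_coeff a n\<bar> \<le> B n"
      by metis
    then have "\<bar>\<Sum>n\<le>M. \<bar>exp_coeff a n\<bar>\<bar> \<le> (\<Sum>n\<le>M. B n)" if "\<forall>k\<in>{1..M}. \<bar>a k\<bar> \<le> A" for a
      using sum_mono[of "{..M}" "\<lambda>n. \<bar>exp_coeff a n\<bar>" B] B that by (simp add: sum_nonneg)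
    then show ?thesis by blast
  qed
  then obtain B where B: "\<And>a. (\<forall>k\<in>{1..M}. \<bar>a k\<bar> \<le> A) \<Longrightarrow> (\<Sum>n\<le>M. \<bar>exp_coeff a n\<bar>) \<le> B"
    by (meson abs_ge_self order_trans)
  \<comment> \<open>G bounds the exponent on [0, 1]. L bounds the coefficient sum of its derivative:
    M terms, each at most \<open>real M * A\<close>.\<close>
  define G where "G = real M * A"
  define L where "L = real M * (real M * A)"
  have G0: "G \<ge> 0" and L0: "L \<ge> 0" using assms by (auto simp: G_def L_def)
  show ?thesis
  proof (intro exI allI impI, elim conjE)
    fix a :: "nat \<Rightarrow> real" and z :: real
    assume a: "\<forall>k\<in>{1..M}. \<bar>a k\<bar> \<le> A" and z: "0 \<le> z" "z \<le> 1"
    define P where "P = (\<lambda>x::real. \<Sum>k=1..M. a k * x ^ k)"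
    define y where "y = (\<lambda>x::real. \<Sum>n\<le>M. exp_coeff a n * x ^ n)"
    define P' where "P' = (\<lambda>x::real. \<Sum>k<M. real (Suc k) * a (Suc k) * x ^ k)"
    define y' where "y' = (\<lambda>x::real. \<Sum>n<M. real (Suc n) * exp_coeff a (Suc n) * x ^ n)"
    have Pbd: "\<bar>P x\<bar> \<le> G" if "0 \<le> x" "x \<le> 1" for x
    proof -
      have "\<bar>P x\<bar> \<le> (\<Sum>k=1..M. \<bar>a k * x ^ k\<bar>)" unfolding P_def by (rule sum_abs)
      also have "\<dots> \<le> (\<Sum>k=1..M. A * 1)"
      proof (intro sum_mono)
        fix k assume "k \<in> {1..M}"
        with a that assms have "\<bar>a k\<bar> * x ^ k \<le> A * 1"
          by (intro mult_mono power_le_one) auto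
        with that show "\<bar>a k * x ^ k\<bar> \<le> A * 1" by (simp add: abs_mult)
      qed
      finally show ?thesis by (simp add: G_def)
    qed
    have dP: "(P has_real_derivative P' x) (at x)" for x
    proof -
      have "(P has_real_derivative (\<Sum>k=1..M. a k * (real k * x ^ (k - Suc 0)))) (at x)"
        unfolding P_def by (auto intro!: derivative_eq_intros sum.cong simp: mult_ac)
      also have "(\<Sum>k=1..M. a k * (real k * x ^ (k - Suc 0))) = P' x"
        unfolding P'_def by (rule sum.reindex_bij_witness[of _ Suc "\<lambda>k. k - 1"]) auto
      finally show ?thesis .
    qed
    have dy: "(y has_real_derivative y' x) (at x)" for x
    proof -
      have "(y has_real_derivative (\<Sum>n\<le>M. exp_coeff a n * (real n * x ^ (n - Suc 0)))) (at x)"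
        unfolding y_def by (auto intro!: derivative_eq_intros sum.cong simp: mult_ac)
      also have "(\<Sum>n\<le>M. exp_coeff a n * (real n * x ^ (n - Suc 0)))
          = (\<Sum>n=1..M. exp_coeff a n * (real n * x ^ (n - Suc 0)))"
        by (rule sum.mono_neutral_right) auto
      also have "\<dots> = y' x"
        unfolding y'_def by (rule sum.reindex_bij_witness[of _ Suc "\<lambda>k. k - 1"]) auto
      finally show ?thesis .
    qed
    \<comment> \<open>\<open>t x i k\<close> is the i-th term of y times the k-th term of P'. By the
      recurrence, y' is exactly the part of the product of total degree below M.\<close>
    define t where "t = (\<lambda>x i k. exp_coeff a i * x ^ i * (real (Suc k) * a (Suc k) * x ^ k))"
    have y'_eq: "y' x = (\<Sum>(i, k)\<in>{(i, k). i + k < M}. t x i k)" for x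
    proof -
      have "y' x = (\<Sum>n<M. \<Sum>i\<le>n. t x i (n - i))"
        unfolding y'_def
      proof (intro sum.cong refl)
        fix n
        have "t x i (n - i) = exp_coeff a i * (real (Suc (n - i)) * a (Suc (n - i))) * x ^ n" if "i \<le> n" for i
          using that unfolding t_def by (simp add: mult_ac flip: power_add del: of_nat_Suc)
        then show "real (Suc n) * exp_coeff a (Suc n) * x ^ n = (\<Sum>i\<le>n. t x i (n - i))"
          unfolding exp_coeff_Suc by (simp add: sum_distrib_right)
      qed
      then show ?thesis by (simp add: sum.triangle_reindex)
    qed
    have Py_eq: "y x * P' x = (\<Sum>(i, k)\<in>{..M} \<times> {..<M}. t x i k)" for x
      unfolding y_def P'_def t_def by (simp add: sum_product sum.cartesian_product)
    \<comment> \<open>Only products of total degree at least M survive in the difference; on [0, 1]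
      these powers are at most \<open>x ^ M\<close>.\<close>
    have res: "\<bar>y' x - y x * P' x\<bar> \<le> B * L * x ^ M" if x: "0 \<le> x" "x \<le> 1" for x
    proof -
      let ?S = "{..M} \<times> {..<M}" and ?D = "{(i, k). i + k < M}"
      have sub: "?D \<subseteq> ?S" by auto
      have "y x * P' x - y' x = (\<Sum>(i, k)\<in>?S - ?D. t x i k)"
        unfolding Py_eq y'_eq using sub by (subst sum_diff) auto
      also have "\<bar>\<dots>\<bar> \<le> (\<Sum>(i, k)\<in>?S - ?D. \<bar>t x i k\<bar>)"
        by (rule order_trans[OF sum_abs]) (simp add: case_prod_beta)
      also have "\<dots> \<le> (\<Sum>(i, k)\<in>?S - ?D. \<bar>exp_coeff a i\<bar> * (real M * A) * x ^ M)"
      proof (rule sum_mono)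
        fix w assume w: "w \<in> ?S - ?D"
        obtain i k where ik: "w = (i, k)" "i \<le> M" "k < M" "i + k \<ge> M" using w by force
        have "\<bar>t x i k\<bar> = \<bar>exp_coeff a i\<bar> * (real (Suc k) * \<bar>a (Suc k)\<bar>) * x ^ (i + k)"
          using x by (simp add: t_def abs_mult power_add mult_ac)
        also have "\<dots> \<le> \<bar>exp_coeff a i\<bar> * (real M * A) * x ^ M"
          using ik a x assms by (intro mult_mono power_decreasing) auto
        finally show "(case w of (i, k) \<Rightarrow> \<bar>t x i k\<bar>) \<le> (case w of (i, k) \<Rightarrow> \<bar>exp_coeff a i\<bar> * (real M * A) * x ^ M)"
          by (simp add: ik)
      qed
      also have "\<dots> \<le> (\<Sum>(i, k)\<in>?S. \<bar>exp_coeff a i\<bar> * (real M * A) * x ^ M)"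
        using x assms by (intro sum_mono2) auto
      also have "\<dots> = (\<Sum>i\<le>M. \<bar>exp_coeff a i\<bar>) * (L * x ^ M)"
        by (simp add: L_def sum_distrib_right sum_distrib_left mult_ac flip: sum.cartesian_product)
      also have "\<dots> \<le> B * (L * x ^ M)"
        using B a x L0 by (intro mult_right_mono) auto
      finally show ?thesis by (simp add: mult_ac abs_minus_commute)
    qed
    define u where "u = (\<lambda>x. y x * exp (- P x))"
    have "norm (u z - u 0) \<le> (exp G * (B * L * z ^ M)) * norm (z - 0)"
    proof (rule field_differentiable_bound[of "{0..z}" u "\<lambda>x. exp (- P x) * (y' x - y x * P' x)"])
      fix x assume x: "x \<in> {0..z}"
      with z have x1: "0 \<le> x" "x \<le> 1" by auto
      show "(u has_real_derivative exp (- P x) * (y' x - y x * P' x)) (at x within {0..z})"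
        unfolding u_def by (rule has_field_derivative_at_within)
          (auto intro!: derivative_eq_intros dy dP simp: algebra_simps)
      have BL: "B * L \<ge> 0"
        using B[rule_format, of a] a L0 by (intro mult_nonneg_nonneg) (auto intro: order_trans[OF sum_nonneg])
      have "\<bar>y' x - y x * P' x\<bar> \<le> B * L * x ^ M" using res x1 by blast
      also have "\<dots> \<le> B * L * z ^ M"
        using x BL by (intro mult_left_mono power_mono) auto
      finally have "\<bar>y' x - y x * P' x\<bar> \<le> B * L * z ^ M" .
      moreover have "exp (- P x) \<le> exp G" using Pbd[OF x1] by simp
      ultimately show "norm (exp (- P x) * (y' x - y x * P' x)) \<le> exp G * (B * L * z ^ M)"
        by (simp add: abs_mult mult_mono)
    qed (use z in auto)
    moreover have "u 0 = 1"
      by (simp add: u_def y_def P_def power_0_left exp_coeff_0 if_distrib sum.delta cong: if_cong)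
    ultimately have "\<bar>u z - 1\<bar> \<le> exp G * (B * L) * z ^ (M + 1)"
      using z by (simp add: mult_ac)
    \<comment> \<open>Going back from u to y multiplies by \<open>exp (P z)\<close>, which gives the
      second factor \<open>exp G\<close> of the constant.\<close>
    moreover have "exp (P z) - y z = - exp (P z) * (u z - 1)"
      by (simp add: u_def algebra_simps flip: exp_add)
    then have "\<bar>exp (P z) - y z\<bar> = exp (P z) * \<bar>u z - 1\<bar>"
      by (simp add: abs_mult)
    moreover have "exp (P z) \<le> exp G" using Pbd[OF z] by simp
    ultimately have "\<bar>exp (P z) - y z\<bar> \<le> exp G * (exp G * (B * L) * z ^ (M + 1))"
      by (simp add: mult_mono)
    then show "\<bar>exp (\<Sum>k=1..M. a k * z ^ k) - (\<Sum>n\<le>M. exp_coeff a n * z ^ n)\<bar>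
        \<le> (exp G * (exp G * (B * L))) * z ^ (M + 1)"
      by (simp add: P_def y_def mult_ac)
  qed
qed

section \<open>Binomial coefficients and power sums\<close>

text \<open>The signed sum for negative r makes this one-step rule hold at every integer, so
  induction can run in both directions.\<close>

lemma S_sum_add_1: "S_sum k h (r + 1) = S_sum k h r + (h + of_int r) ^ k"
proof -
  consider "r \<ge> 1" | "r = 0" | "r = - 1" | "r < - 1" by linarith
  then show ?thesis
  proof cases
    case 1
    then have "{0..r} = insert r {0..r - 1}" by auto
    with 1 show ?thesis by (simp add: S_sum_def)
  next
    case 4
    then have "{1..- r} = insert (- r) {1..- r - 1}" by auto
    with 4 show ?thesis by (simp add: S_sum_def)
  qed (auto simp: S_sum_def)
qed

text \<open>T is the trapezoidal version of S: half a unit of weight moves from the endpoint h to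
  the endpoint h + r.\<close>

lemma T_sum_eq: "T_sum k h r = S_sum k h r - h ^ k / 2 + (h + of_int r) ^ k / 2"
proof -
  consider "r \<ge> 1" | "r = 0" | "r \<le> - 1" by linarith
  then show ?thesis
  proof cases
    case 1
    then have "{0..r - 1} = insert 0 {1..r - 1}" by auto
    with 1 show ?thesis by (simp add: S_sum_def T_sum_def)
  next
    case 3
    then have "{1..- r} = insert (- r) {1..- r - 1}" by auto
    with 3 show ?thesis by (simp add: S_sum_def T_sum_def)
  qed (auto simp: S_sum_def T_sum_def)
qed

lemma bernpoly_add_int: "bernpoly (k + 1) (h + of_int r) = bernpoly (k + 1) h + real (k + 1) * S_sum k h r"
proof -
  \<comment> \<open>This difference is invariant under i \<mapsto> i + 1, so one identity serves
    both directions of the induction.\<close>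
  have step: "bernpoly (k + 1) (h + of_int (i + 1)) - real (k + 1) * S_sum k h (i + 1)
      = bernpoly (k + 1) (h + of_int i) - real (k + 1) * S_sum k h i" for i
    using bernpoly_add_1[of k "h + of_int i"]
    by (simp add: S_sum_add_1 add.assoc distrib_left del: of_nat_Suc)
  have "bernpoly (k + 1) (h + of_int r) - real (k + 1) * S_sum k h r = bernpoly (k + 1) h"
  proof (induction r rule: int_induct[where k = 0])
    case base
    show ?case by (simp add: S_sum_def)
  next
    case (step1 i)
    then show ?case by (simp only: step)
  next
    case (step2 i)
    then show ?case using step[of "i - 1"] by simp
  qed
  then show ?thesis by simp
qed

text \<open>With the power sum absorbed into the Bernoulli polynomial, h and r enter only through
  the offset s = h + r.\<close>

definition coeff_at :: "nat \<Rightarrow> real \<Rightarrow> real \<Rightarrow> real" where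
  "coeff_at k p s = ((- 1) ^ (k + 1) * bernoulli (k + 1) - Xi k p * bernpoly (k + 1) s) / (real k * real (k + 1))"

lemma coeff1_eq: "k \<ge> 1 \<Longrightarrow> coeff1 N p r k = coeff_at k p (hh N p + of_int r)"
  unfolding coeff1_def A_tilde_def coeff_at_def bernpoly_add_int
  by (simp add: divide_simps) (simp add: algebra_simps)

text \<open>Averaging the Bernoulli polynomial and halving the weight at h each produce a term in
  \<open>h ^ k\<close>. The two cancel, and only the endpoint h + r remains.\<close>

lemma coeff2_eq:
  assumes "k \<ge> 1"
  shows "coeff2 N p r k = coeff1 N p r k - Xi k p * (hh N p + of_int r) ^ k / (2 * real k)"
proof -
  define h where "h = hh N p"
  have "bernpoly_avg (k + 1) h = bernpoly (k + 1) h + real (k + 1) * h ^ k / 2"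
    using bernpoly_add_1[of k h] by (simp add: bernpoly_avg_def field_simps del: of_nat_Suc)
  then have "A_hat k h p = A_tilde k h p - Xi k p * (real (k + 1) * h ^ k / 2) / (real k * real (k + 1))"
    unfolding A_hat_def A_tilde_def by (simp add: diff_divide_distrib add_divide_distrib distrib_left)
  also have "Xi k p * (real (k + 1) * h ^ k / 2) / (real k * real (k + 1)) = Xi k p / real k * (h ^ k / 2)"
    using assms by simp
  finally show ?thesis
    unfolding coeff1_def coeff2_def T_sum_eq h_def[symmetric]
    by (simp add: algebra_simps)
qed

text \<open>Since N p + s = m and N q - s = N - m, all logarithms with factors m or N - m cancel,
  leaving half-logarithms and \<open>- ln m\<close>. The summand \<open>ln N - ln m\<close> turns
  (N-1)!/(m-1)! into N!/m!.\<close>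

lemma stirling_main_binomial:
  assumes p: "0 < p" "p < 1" and N: "0 < N" and m: "0 < m" and q: "q = 1 - p"
  shows "stirling_main M N 0 - stirling_main M (N * p) (m - N * p) - stirling_main M (N * q) (1 - (m - N * p))
      + ln N - ln m + m * ln p + (N - m) * ln q
    = (ln N + ln p - ln q) / 2 - ln m + (\<Sum>k=1..M. coeff_at k p (m - N * p) / N ^ k)"
proof -
  define s where "s = m - N * p"
  have q0: "q > 0" using p q by simp
  have "(\<Sum>k=1..M. coeff_at k p s / N ^ k)
      = (\<Sum>k=1..M. (- 1) ^ (k + 1) * bernpoly (k + 1) 0 / (real k * real (k + 1) * N ^ k)
         - (- 1) ^ (k + 1) * bernpoly (k + 1) s / (real k * real (k + 1) * (N * p) ^ k)
         - (- 1) ^ (k + 1) * bernpoly (k + 1) (1 - s) / (real k * real (k + 1) * (N * q) ^ k))"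
  proof (intro sum.cong refl)
    fix k assume "k \<in> {1..M}"
    \<comment> \<open>Reflection removes the sign from the terms belonging to N - m, so they give
      the part \<open>1 / (1 - p) ^ k\<close> of \<open>Xi\<close>; those belonging to m give its
      alternating part.\<close>
    have refl: "(- 1) ^ (k + 1) * bernpoly (k + 1) (1 - s) = bernpoly (k + 1) s"
      unfolding bernpoly_reflect by (simp flip: power_mult_distrib mult.assoc)
    have split: "(e * b - (e / P + 1 / Q) * c) / d / n = e * b / (d * n) - e * c / (d * (n * P)) - c / (d * (n * Q))"
      for e b P Q c d n :: real
      by (simp add: diff_divide_distrib add_divide_distrib distrib_left distrib_right mult_ac)
    show "coeff_at k p s / N ^ k = (- 1) ^ (k + 1) * bernpoly (k + 1) 0 / (real k * real (k + 1) * N ^ k)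
         - (- 1) ^ (k + 1) * bernpoly (k + 1) s / (real k * real (k + 1) * (N * p) ^ k)
         - (- 1) ^ (k + 1) * bernpoly (k + 1) (1 - s) / (real k * real (k + 1) * (N * q) ^ k)"
      unfolding coeff_at_def Xi_def bernoulli_def power_mult_distrib q by (simp only: refl split)
  qed
  moreover have "ln (N * p) = ln N + ln p" "ln (N * q) = ln N + ln q"
    using p q0 N by (auto simp: ln_mult)
  ultimately show ?thesis
    unfolding stirling_main_def s_def[symmetric]
    by (simp only: sum_subtractf) (simp add: s_def q field_simps)
qed

lemma inverse_power_bound:
  assumes "0 < d" "0 < (N::real)" "d * N \<le> x"
  shows "C / x ^ n \<le> \<bar>C\<bar> / d ^ n / N ^ n"
proof -
  have "C / x ^ n \<le> \<bar>C\<bar> / (d * N) ^ n"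
    using assms by (intro frac_le power_mono) (auto intro!: zero_less_power)
  then show ?thesis by (simp add: power_mult_distrib)
qed

text \<open>The margin d keeps m and N - m of order N, so the three Stirling errors are all powers
  of 1/N. Of the three constants \<open>ln (2 * pi) / 2\<close> one survives, with a minus
  sign.\<close>

lemma ln_binomial_prob_expansion:
  assumes d: "0 < d" and T: "0 < T"
  shows "\<exists>C N0. \<forall>N\<ge>N0. \<forall>p m. d \<le> p \<and> p \<le> 1 - d \<and> \<bar>real m - real N * p\<bar> \<le> T \<longrightarrow>
     0 < m \<and> m < N \<and>
     \<bar>ln (real (N choose m) * p ^ m * (1 - p) ^ (N - m))
       - ((ln N + ln p - ln (1 - p)) / 2 - ln m - ln (2 * pi) / 2
          + (\<Sum>k=1..M. coeff_at k p (real m - real N * p) / real N ^ k))\<bar> \<le> C / real N ^ (M + 1)"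
proof -
  obtain C1 where C1: "\<forall>m\<ge>1. \<bar>ln (fact (m - 1)) - stirling_main M (real m) 0 - ln (2 * pi) / 2\<bar> \<le> C1 / real m ^ (M + 1)"
    using ln_fact_stirling ..
  \<comment> \<open>The range T + 1 covers both shifts s and 1 - s.\<close>
  have "T + 1 > 0" using T by simp
  from ln_fact_stirling_shifted[OF this] obtain C2 where
    C2: "\<forall>m t. 1 \<le> m \<and> 2 * (T + 1) \<le> real m \<and> \<bar>t\<bar> \<le> T + 1 \<longrightarrow>
      \<bar>ln (fact (m - 1)) - stirling_main M (real m - t) t - ln (2 * pi) / 2\<bar> \<le> C2 / real m ^ (M + 1)" ..
  define C3 where "C3 = \<bar>C2\<bar> / (d / 2) ^ (M + 1)"
  \<comment> \<open>Then d N \<ge> 4(T + 1), so m and N - m are at least d N / 2 and hence at least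
    the 2(T + 1) that the shifted expansion requires.\<close>
  obtain N0 :: nat where N0: "4 * (T + 1) / d \<le> real N0" using real_arch_simple by blast
  show ?thesis
  proof (rule exI[of _ "C1 + C3 + C3"], rule exI[of _ N0], intro allI impI, elim conjE)
    fix N p m assume N: "N0 \<le> N" and p: "d \<le> p" "p \<le> 1 - d" and m: "\<bar>real m - real N * p\<bar> \<le> T"
    define q where "q = 1 - p"
    define s where "s = real m - real N * p"
    from N0 N have "4 * (T + 1) / d \<le> real N" by linarith
    with d have dN: "4 * (T + 1) \<le> d * real N" by (simp add: field_simps)
    have Npos: "real N > 0" using dN T d by (metis add_pos_pos less_le_trans mult_pos_pos zero_less_mult_pos zero_less_numeral zero_less_one)
    have pN: "d * real N \<le> real N * p" "d * real N \<le> real N * q"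
      using p Npos by (auto simp: q_def mult.commute[of d] intro!: mult_left_mono)
    have Nq: "real N * q = real N - real N * p" by (simp add: q_def algebra_simps)
    have aux: "x / 2 \<le> c" if "x \<le> y" "\<bar>c - y\<bar> \<le> T" "4 * (T + 1) \<le> x" for x y c
      using that T by (simp add: abs_le_iff)
    have mlow: "d / 2 * real N \<le> real m"
      using aux[OF pN(1) m dN] by simp
    have "\<bar>(real N - real m) - real N * q\<bar> \<le> T" using m by (simp add: Nq abs_minus_commute)
    from aux[OF pN(2) this dN] have mhigh: "d / 2 * real N \<le> real N - real m" by simp
    from mlow mhigh have mN: "0 < m" "m < N" using Npos d
      by (metis half_gt_zero less_le_trans mult_pos_pos of_nat_0_less_iff, smt (verit) half_gt_zero mult_pos_pos of_nat_less_iff)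
    have e1: "\<bar>ln (fact (N - 1)) - stirling_main M (real N) 0 - ln (2 * pi) / 2\<bar> \<le> C1 / real N ^ (M + 1)"
      using C1 mN by simp
    have "\<bar>ln (fact (m - 1)) - stirling_main M (real m - s) s - ln (2 * pi) / 2\<bar> \<le> C2 / real m ^ (M + 1)"
      using C2[rule_format, of m s] mN mlow dN m T by (simp add: s_def)
    also have "\<dots> \<le> C3 / real N ^ (M + 1)"
      unfolding C3_def using d Npos mlow by (intro inverse_power_bound) auto
    also have "real m - s = real N * p" by (simp add: s_def)
    finally have e2: "\<bar>ln (fact (m - 1)) - stirling_main M (real N * p) s - ln (2 * pi) / 2\<bar> \<le> C3 / real N ^ (M + 1)" .
    \<comment> \<open>Written this way, (N - m)! is expanded at N - m + 1, and subtracting the shift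
      1 - s gives exactly N q.\<close>
    have "\<bar>ln (fact (N - m + 1 - 1)) - stirling_main M (real (N - m + 1) - (1 - s)) (1 - s) - ln (2 * pi) / 2\<bar>
        \<le> C2 / real (N - m + 1) ^ (M + 1)"
    proof (rule C2[rule_format], intro conjI)
      show "2 * (T + 1) \<le> real (N - m + 1)" using mhigh mN dN by (simp add: of_nat_diff)
      show "\<bar>1 - s\<bar> \<le> T + 1" using m by (simp add: s_def abs_le_iff)
    qed simp
    also have "\<dots> \<le> C3 / real N ^ (M + 1)"
      unfolding C3_def using d Npos mhigh mN by (intro inverse_power_bound) (auto simp: of_nat_diff)
    also have "real (N - m + 1) - (1 - s) = real N * q"
      using mN by (simp add: s_def Nq of_nat_diff)
    finally have e3: "\<bar>ln (fact (N - m)) - stirling_main M (real N * q) (1 - s) - ln (2 * pi) / 2\<bar> \<le> C3 / real N ^ (M + 1)"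
      by simp
    have pq: "0 < p" "p < 1" "0 < q" using p d by (auto simp: q_def)
    have "ln (real (N choose m) * p ^ m * q ^ (N - m))
        = ln (fact N) - ln (fact m) - ln (fact (N - m)) + real m * ln p + (real N - real m) * ln q"
      using mN pq by (simp add: binomial_fact ln_mult ln_div ln_realpow of_nat_diff)
    also have "ln (fact N) = ln (real N) + ln (fact (N - 1))"
      using mN fact_reduce[of N, where 'a = real] by (simp add: ln_mult)
    also have "ln (fact m) = ln (real m) + ln (fact (m - 1))"
      using mN fact_reduce[of m, where 'a = real] by (simp add: ln_mult)
    finally have "ln (real (N choose m) * p ^ m * q ^ (N - m))
      - ((ln N + ln p - ln q) / 2 - ln m - ln (2 * pi) / 2 + (\<Sum>k=1..M. coeff_at k p s / real N ^ k))
      = (ln (fact (N - 1)) - stirling_main M (real N) 0 - ln (2 * pi) / 2)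
        - (ln (fact (m - 1)) - stirling_main M (real N * p) s - ln (2 * pi) / 2)
        - (ln (fact (N - m)) - stirling_main M (real N * q) (1 - s) - ln (2 * pi) / 2)"
      using stirling_main_binomial[of p "real N" "real m" q M] pq mN
      unfolding s_def[symmetric] by (simp add: q_def)
    with e1 e2 e3 have "\<bar>ln (real (N choose m) * p ^ m * q ^ (N - m))
      - ((ln N + ln p - ln q) / 2 - ln m - ln (2 * pi) / 2 + (\<Sum>k=1..M. coeff_at k p s / real N ^ k))\<bar>
      \<le> (C1 + C3 + C3) / real N ^ (M + 1)"
      unfolding add_divide_distrib by linarith
    with mN show "0 < m \<and> m < N \<and> \<bar>ln (real (N choose m) * p ^ m * (1 - p) ^ (N - m))
      - ((ln N + ln p - ln (1 - p)) / 2 - ln m - ln (2 * pi) / 2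
         + (\<Sum>k=1..M. coeff_at k p (real m - real N * p) / real N ^ k))\<bar> \<le> (C1 + C3 + C3) / real N ^ (M + 1)"
      by (simp add: q_def s_def)
  qed
qed

section \<open>From logarithmic to multiplicative expansions\<close>

text \<open>In this form errors add. Positivity of f and P is recorded so that exponentiation
  recovers both from their logarithms.\<close>

definition log_expansion ::
  "real set \<Rightarrow> nat \<Rightarrow> (nat \<Rightarrow> real \<Rightarrow> int \<Rightarrow> real) \<Rightarrow> (nat \<Rightarrow> real \<Rightarrow> int \<Rightarrow> bool)
    \<Rightarrow> (nat \<Rightarrow> real \<Rightarrow> int \<Rightarrow> real) \<Rightarrow> (nat \<Rightarrow> real \<Rightarrow> int \<Rightarrow> nat \<Rightarrow> real) \<Rightarrow> bool" where
  "log_expansion K R f wd P a \<longleftrightarrow>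
     (\<forall>M. \<exists>C N0. \<forall>N\<ge>N0. \<forall>p\<in>K. \<forall>r. \<bar>r\<bar> \<le> int R \<longrightarrow>
        wd N p r \<and> 0 < f N p r \<and> 0 < P N p r \<and>
        \<bar>ln (f N p r) - (ln (P N p r) + (\<Sum>k=1..M. a N p r k / real N ^ k))\<bar> \<le> C / real N ^ (M + 1))"

lemma abs_exp_minus_1_le: "\<bar>x\<bar> \<le> c \<Longrightarrow> \<bar>exp x - 1\<bar> \<le> exp c * \<bar>x\<bar>" for x :: real
proof -
  assume x: "\<bar>x\<bar> \<le> c"
  have "norm (exp x - exp 0) \<le> exp c * norm (x - 0)"
  proof (rule field_differentiable_bound[of "{- c..c}" exp exp])
    fix z assume "z \<in> {- c..c}"
    show "(exp has_real_derivative exp z) (at z within {- c..c})"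
      by (rule has_field_derivative_at_within[OF DERIV_exp])
  qed (use x in auto)
  then show ?thesis by simp
qed

lemma exp_expansion_of_log:
  assumes "log_expansion K R f wd P a"
  shows "exp_expansion K R f wd P a"
  unfolding exp_expansion_def
proof
  fix M
  obtain C N0 where C: "\<And>N p r. N \<ge> N0 \<Longrightarrow> p \<in> K \<Longrightarrow> \<bar>r\<bar> \<le> int R \<Longrightarrow>
        wd N p r \<and> 0 < f N p r \<and> 0 < P N p r \<and>
        \<bar>ln (f N p r) - (ln (P N p r) + (\<Sum>k=1..M. a N p r k / real N ^ k))\<bar> \<le> C / real N ^ (M + 1)"
    using assms unfolding log_expansion_def by meson
  show "\<exists>C N0. \<forall>N\<ge>N0. \<forall>p\<in>K. \<forall>r. \<bar>r\<bar> \<le> int R \<longrightarrow> wd N p r \<and>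
        (\<exists>\<epsilon>. f N p r = P N p r * exp (\<Sum>k=1..M. a N p r k / real N ^ k) * (1 + \<epsilon>) \<and>
             \<bar>\<epsilon>\<bar> \<le> C / real N ^ (M + 1))"
  proof (rule exI[of _ "exp \<bar>C\<bar> * C"], rule exI[of _ "max N0 1"], intro allI ballI impI)
    fix N p and r :: int assume N: "max N0 1 \<le> N" and p: "p \<in> K" and r: "\<bar>r\<bar> \<le> int R"
    let ?S = "\<Sum>k=1..M. a N p r k / real N ^ k"
    define D where "D = ln (f N p r) - (ln (P N p r) + ?S)"
    from C[of N p r] N p r have *: "wd N p r" "0 < f N p r" "0 < P N p r" "\<bar>D\<bar> \<le> C / real N ^ (M + 1)"
      by (auto simp: D_def)
    \<comment> \<open>For N \<ge> 1 the error D is bounded by a constant, so passing to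
      \<open>exp D - 1\<close> costs only a fixed factor.\<close>
    have "1 \<le> real N ^ (M + 1)" using N by (intro one_le_power) auto
    then have "C / real N ^ (M + 1) \<le> \<bar>C\<bar> / 1" by (intro frac_le) auto
    with *(4) have "\<bar>D\<bar> \<le> \<bar>C\<bar>" by simp
    then have "\<bar>exp D - 1\<bar> \<le> exp \<bar>C\<bar> * \<bar>D\<bar>" by (rule abs_exp_minus_1_le)
    also have "\<dots> \<le> exp \<bar>C\<bar> * (C / real N ^ (M + 1))"
      using *(4) by (intro mult_left_mono) auto
    finally have "\<bar>exp D - 1\<bar> \<le> exp \<bar>C\<bar> * C / real N ^ (M + 1)" by simp
    moreover have "f N p r = exp (ln (P N p r) + ?S + D)"
      using *(2) by (simp add: D_def)
    then have "f N p r = P N p r * exp ?S * (1 + (exp D - 1))"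
      using *(3) by (simp add: exp_add)
    ultimately show "wd N p r \<and> (\<exists>\<epsilon>. f N p r = P N p r * exp ?S * (1 + \<epsilon>) \<and>
             \<bar>\<epsilon>\<bar> \<le> exp \<bar>C\<bar> * C / real N ^ (M + 1))"
      using *(1) by blast
  qed
qed

text \<open>The coefficients vary with N through h; a bound free of N, p and r lets the re-expansion
  use one constant.\<close>

definition coeffs_bounded :: "real set \<Rightarrow> nat \<Rightarrow> (nat \<Rightarrow> real \<Rightarrow> int \<Rightarrow> nat \<Rightarrow> real) \<Rightarrow> bool" where
  "coeffs_bounded K R a \<longleftrightarrow>
     (\<forall>k\<ge>1. \<exists>A. \<forall>N. \<forall>p\<in>K. \<forall>r. \<bar>r\<bar> \<le> int R \<longrightarrow> \<bar>a N p r k\<bar> \<le> A)"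

text \<open>With z = 1/N, the new error is the truncation error of the exponential plus the
  exponential times the old error.\<close>

lemma series_expansion_of_exp:
  assumes exp: "exp_expansion K R f wd P a" and bdd: "coeffs_bounded K R a"
  shows "series_expansion K R f wd P a"
  unfolding series_expansion_def
proof
  fix M
  obtain C N0 where C: "\<And>N p r. N \<ge> N0 \<Longrightarrow> p \<in> K \<Longrightarrow> \<bar>r\<bar> \<le> int R \<Longrightarrow> wd N p r \<and>
        (\<exists>\<epsilon>. f N p r = P N p r * exp (\<Sum>k=1..M. a N p r k / real N ^ k) * (1 + \<epsilon>) \<and>
             \<bar>\<epsilon>\<bar> \<le> C / real N ^ (M + 1))"
    using exp unfolding exp_expansion_def by meson
  obtain A0 where A0: "\<And>k N p r. k \<ge> 1 \<Longrightarrow> p \<in> K \<Longrightarrow> \<bar>r\<bar> \<le> int R \<Longrightarrow> \<bar>a N p r k\<bar> \<le> A0 k"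
    using bdd unfolding coeffs_bounded_def by metis
  define A where "A = (\<Sum>k=1..M. \<bar>A0 k\<bar>)"
  have A: "\<bar>a N p r k\<bar> \<le> A" if "k \<in> {1..M}" "p \<in> K" "\<bar>r\<bar> \<le> int R" for k N p r
  proof -
    have "\<bar>A0 k\<bar> \<le> A" unfolding A_def using that(1) by (intro member_le_sum) auto
    with A0[of k p r N] that show ?thesis by force
  qed
  have "A \<ge> 0" by (simp add: A_def sum_nonneg)
  from exp_coeff_truncation[OF this, of M] obtain B where
    B: "\<forall>a z. (\<forall>k\<in>{1..M}. \<bar>a k\<bar> \<le> A) \<and> 0 \<le> z \<and> z \<le> 1 \<longrightarrow>
     \<bar>exp (\<Sum>k=1..M. a k * z ^ k) - (\<Sum>n\<le>M. exp_coeff a n * z ^ n)\<bar> \<le> B * z ^ (M + 1)" ..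
  define G where "G = exp (real M * A)"
  show "\<exists>C N0. \<forall>N\<ge>N0. \<forall>p\<in>K. \<forall>r. \<bar>r\<bar> \<le> int R \<longrightarrow> wd N p r \<and>
        (\<exists>\<epsilon>. f N p r = P N p r * ((\<Sum>n=0..M. exp_coeff (a N p r) n / real N ^ n) + \<epsilon>) \<and>
             \<bar>\<epsilon>\<bar> \<le> C / real N ^ (M + 1))"
  proof (rule exI[of _ "B + G * C"], rule exI[of _ "max N0 1"], intro allI ballI impI)
    fix N p and r :: int assume N: "max N0 1 \<le> N" and p: "p \<in> K" and r: "\<bar>r\<bar> \<le> int R"
    let ?S = "\<Sum>k=1..M. a N p r k / real N ^ k" and ?Y = "\<Sum>n=0..M. exp_coeff (a N p r) n / real N ^ n"
    obtain e where e: "wd N p r" "f N p r = P N p r * exp ?S * (1 + e)" "\<bar>e\<bar> \<le> C / real N ^ (M + 1)"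
      using C[of N p r] N p r by auto
    have "\<bar>exp (\<Sum>k=1..M. a N p r k * (1 / real N) ^ k) - (\<Sum>n\<le>M. exp_coeff (a N p r) n * (1 / real N) ^ n)\<bar>
        \<le> B * (1 / real N) ^ (M + 1)"
      using B[rule_format, of "a N p r" "1 / real N"] A p r N by auto
    then have Y: "\<bar>exp ?S - ?Y\<bar> \<le> B / real N ^ (M + 1)"
      by (simp add: power_one_over atLeast0AtMost)
    have "\<bar>?S\<bar> \<le> (\<Sum>k=1..M. \<bar>a N p r k / real N ^ k\<bar>)" by (rule sum_abs)
    also have "\<dots> \<le> (\<Sum>k=1..M. A)"
    proof (rule sum_mono)
      fix k assume k: "k \<in> {1..M}"
      have "1 \<le> real N ^ k" using N by (intro one_le_power) auto
      then have "\<bar>a N p r k\<bar> / real N ^ k \<le> A / 1"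
        using A[OF k p r, of N] by (intro frac_le) auto
      then show "\<bar>a N p r k / real N ^ k\<bar> \<le> A" by simp
    qed
    finally have "exp ?S \<le> G" by (simp add: G_def)
    then have "exp ?S * \<bar>e\<bar> \<le> G * (C / real N ^ (M + 1))"
      using e(3) by (intro mult_mono) (auto simp: G_def)
    then have "\<bar>exp ?S * e\<bar> \<le> G * C / real N ^ (M + 1)" by (simp add: abs_mult)
    with Y have "\<bar>exp ?S - ?Y + exp ?S * e\<bar> \<le> (B + G * C) / real N ^ (M + 1)"
      unfolding add_divide_distrib by linarith
    moreover have "f N p r = P N p r * (?Y + (exp ?S - ?Y + exp ?S * e))"
      unfolding e(2) by (simp add: algebra_simps)
    ultimately show "wd N p r \<and> (\<exists>\<epsilon>. f N p r = P N p r * (?Y + \<epsilon>) \<and> \<bar>\<epsilon>\<bar> \<le> (B + G * C) / real N ^ (M + 1))"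
      using e(1) by blast
  qed
qed

section \<open>The binomial probability\<close>

text \<open>All later estimates are uniform in p through the margin d alone.\<close>

lemma compact_subset_open_unit_interval:
  fixes K :: "real set"
  assumes "compact K" "K \<subseteq> {0<..<1}"
  shows "\<exists>d>0. \<forall>p\<in>K. d \<le> p \<and> p \<le> 1 - d"
proof (cases "K = {}")
  case False
  from compact_attains_inf[OF assms(1) False] compact_attains_sup[OF assms(1) False]
  obtain x y where x: "x \<in> K" "\<forall>t\<in>K. x \<le> t" and y: "y \<in> K" "\<forall>t\<in>K. t \<le> y" by blast
  with assms(2) show ?thesis by (intro exI[of _ "min x (1 - y)"]) force
qed (auto intro: exI[of _ 1])

lemma hh_bounds: "0 \<le> hh N p" "hh N p < 1"
  using ceiling_correct[of "real N * p"] by (auto simp: hh_def nu_def)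

lemma offset_bound: "\<bar>r\<bar> \<le> int R \<Longrightarrow> \<bar>hh N p + of_int r\<bar> \<le> real R + 1"
  using hh_bounds[of N p] by linarith

lemma bin_prob_eq:
  assumes "0 \<le> p" "p \<le> 1" "nu N p + r = int m" "m \<le> N"
  shows "bin_prob N p r = real (N choose m) * p ^ m * (1 - p) ^ (N - m)"
proof -
  have "{x. int x = nu N p + r} = {m}" using assms(3) by auto
  then show ?thesis
    using assms by (simp add: bin_prob_def measure_pmf_single)
qed

lemma bin_prob_log_expansion:
  assumes d: "0 < d" and K: "\<forall>p\<in>K. d \<le> p \<and> p \<le> 1 - d"
  shows "\<exists>C N0. \<forall>N\<ge>N0. \<forall>p\<in>K. \<forall>r. \<bar>r\<bar> \<le> int R \<longrightarrow>
     0 < nu N p + r \<and> nu N p + r < int N \<and> 0 < bin_prob N p r \<and>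
     \<bar>ln (bin_prob N p r)
       - ((ln N + ln p - ln (1 - p)) / 2 - ln (of_int (nu N p + r)) - ln (2 * pi) / 2
          + (\<Sum>k=1..M. coeff1 N p r k / real N ^ k))\<bar> \<le> C / real N ^ (M + 1)"
proof -
  have "real R + 1 > 0" by simp
  from ln_binomial_prob_expansion[OF d this, of M] obtain C N0 where
    C: "\<forall>N\<ge>N0. \<forall>p m. d \<le> p \<and> p \<le> 1 - d \<and> \<bar>real m - real N * p\<bar> \<le> real R + 1 \<longrightarrow>
     0 < m \<and> m < N \<and>
     \<bar>ln (real (N choose m) * p ^ m * (1 - p) ^ (N - m))
       - ((ln N + ln p - ln (1 - p)) / 2 - ln m - ln (2 * pi) / 2
          + (\<Sum>k=1..M. coeff_at k p (real m - real N * p) / real N ^ k))\<bar> \<le> C / real N ^ (M + 1)"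
    by (elim exE)
  \<comment> \<open>This threshold forces N p \<ge> R + 1, hence nu + r \<ge> 0, so there is a
    natural number m to which the expansion applies.\<close>
  obtain N1 :: nat where N1: "(real R + 1) / d \<le> real N1" using real_arch_simple by blast
  show ?thesis
  proof (rule exI[of _ C], rule exI[of _ "max N0 N1"], intro allI ballI impI)
    fix N p and r :: int assume N: "max N0 N1 \<le> N" and p: "p \<in> K" and r: "\<bar>r\<bar> \<le> int R"
    from bspec[OF K p] have dp: "d \<le> p" "p \<le> 1 - d" by auto
    have "(real R + 1) / d \<le> real N" using N1 N by linarith
    with d have "real R + 1 \<le> d * real N" by (simp add: field_simps)
    also have "\<dots> \<le> real N * p" using dp by (simp add: mult.commute[of d] mult_left_mono)
    finally have "real_of_int (nu N p + r) \<ge> 0"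
      using offset_bound[OF r, of N p] by (simp add: hh_def abs_le_iff)
    then have "nu N p + r \<ge> 0" by linarith
    then obtain m where m: "nu N p + r = int m" using nonneg_int_cases by blast
    then have "real_of_int (nu N p + r) = real m" by simp
    then have s: "hh N p + of_int r = real m - real N * p" by (simp add: hh_def)
    with offset_bound[OF r, of N p] have "\<bar>real m - real N * p\<bar> \<le> real R + 1" by simp
    with C N dp have *: "0 < m" "m < N" "\<bar>ln (real (N choose m) * p ^ m * (1 - p) ^ (N - m))
       - ((ln N + ln p - ln (1 - p)) / 2 - ln m - ln (2 * pi) / 2
          + (\<Sum>k=1..M. coeff_at k p (real m - real N * p) / real N ^ k))\<bar> \<le> C / real N ^ (M + 1)"
      by auto
    have pq: "0 < p" "p < 1" using dp d by auto
    have f: "bin_prob N p r = real (N choose m) * p ^ m * (1 - p) ^ (N - m)"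
      using pq m *(2) by (intro bin_prob_eq) auto
    have "(\<Sum>k=1..M. coeff1 N p r k / real N ^ k) = (\<Sum>k=1..M. coeff_at k p (real m - real N * p) / real N ^ k)"
      by (intro sum.cong refl) (simp add: coeff1_eq s del: One_nat_def)
    then show "0 < nu N p + r \<and> nu N p + r < int N \<and> 0 < bin_prob N p r \<and>
     \<bar>ln (bin_prob N p r)
       - ((ln N + ln p - ln (1 - p)) / 2 - ln (of_int (nu N p + r)) - ln (2 * pi) / 2
          + (\<Sum>k=1..M. coeff1 N p r k / real N ^ k))\<bar> \<le> C / real N ^ (M + 1)"
      using * pq unfolding m f by simp
  qed
qed

text \<open>As N p + h + r = nu + r, the logarithm of the prefactor is exactly the main part already
  found; no new error arises.\<close>

lemma bin_prob_log_expansion_pre1: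
  assumes d: "0 < d" and K: "\<forall>p\<in>K. d \<le> p \<and> p \<le> 1 - d"
  shows "log_expansion K R bin_prob pre1_wd pre1 coeff1"
  unfolding log_expansion_def
proof
  fix M
  obtain C N0 where C: "\<forall>N\<ge>N0. \<forall>p\<in>K. \<forall>r. \<bar>r\<bar> \<le> int R \<longrightarrow>
     0 < nu N p + r \<and> nu N p + r < int N \<and> 0 < bin_prob N p r \<and>
     \<bar>ln (bin_prob N p r)
       - ((ln N + ln p - ln (1 - p)) / 2 - ln (of_int (nu N p + r)) - ln (2 * pi) / 2
          + (\<Sum>k=1..M. coeff1 N p r k / real N ^ k))\<bar> \<le> C / real N ^ (M + 1)"
    using bin_prob_log_expansion[OF d K, where R = R and M = M] by (elim exE)
  show "\<exists>C N0. \<forall>N\<ge>N0. \<forall>p\<in>K. \<forall>r. \<bar>r\<bar> \<le> int R \<longrightarrow>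
        pre1_wd N p r \<and> 0 < bin_prob N p r \<and> 0 < pre1 N p r \<and>
        \<bar>ln (bin_prob N p r) - (ln (pre1 N p r) + (\<Sum>k=1..M. coeff1 N p r k / real N ^ k))\<bar> \<le> C / real N ^ (M + 1)"
  proof (rule exI[of _ C], rule exI[of _ N0], intro allI ballI impI)
    fix N p and r :: int assume N: "N0 \<le> N" and p: "p \<in> K" and r: "\<bar>r\<bar> \<le> int R"
    from bspec[OF K p] d have pq: "0 < p" "0 < 1 - p" by auto
    define m where "m = real_of_int (nu N p + r)"
    have *: "0 < nu N p + r" "nu N p + r < int N" "0 < bin_prob N p r"
      "\<bar>ln (bin_prob N p r) - ((ln N + ln p - ln (1 - p)) / 2 - ln m - ln (2 * pi) / 2
          + (\<Sum>k=1..M. coeff1 N p r k / real N ^ k))\<bar> \<le> C / real N ^ (M + 1)"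
      using C N p r by (auto simp: m_def)
    have m0: "m > 0" using *(1) by (simp add: m_def)
    have N0: "real N > 0" using *(1,2) by simp
    have m: "real N * p + hh N p + of_int r = m" by (simp add: m_def hh_def)
    have r0: "2 * pi * real N * p * (1 - p) > 0" using pq N0 by simp
    have P0: "pre1 N p r > 0"
      unfolding pre1_def m using m0 N0 pq(1) r0 by (intro mult_pos_pos divide_pos_pos) auto
    have "ln (pre1 N p r) = ln (real N * p) - ln m - ln (2 * pi * real N * p * (1 - p)) / 2"
      unfolding pre1_def m using m0 N0 pq r0 by (simp add: ln_mult ln_div ln_sqrt)
    also have "ln (real N * p) = ln N + ln p" using N0 pq by (simp add: ln_mult)
    also have "ln (2 * pi * real N * p * (1 - p)) = ln (2 * pi) + ln N + ln p + ln (1 - p)"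
      using N0 pq ln_mult_pos[of "2 * pi * real N * p" "1 - p"] ln_mult_pos[of "2 * pi * real N" p]
        ln_mult_pos[of "2 * pi" "real N"] by simp
    finally have "ln (pre1 N p r) = (ln N + ln p - ln (1 - p)) / 2 - ln m - ln (2 * pi) / 2"
      by (simp add: field_simps)
    with * P0 m0 m r0 show "pre1_wd N p r \<and> 0 < bin_prob N p r \<and> 0 < pre1 N p r \<and>
        \<bar>ln (bin_prob N p r) - (ln (pre1 N p r) + (\<Sum>k=1..M. coeff1 N p r k / real N ^ k))\<bar> \<le> C / real N ^ (M + 1)"
      by (simp add: pre1_wd_def)
  qed
qed

text \<open>The logarithms of \<open>pre1\<close> and \<open>pre2\<close> differ by half of ln(1 -
  s/(N q)) - ln(1 + s/(N p)), and the truncated series of this are the terms by which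
  \<open>coeff2\<close> differs from \<open>coeff1\<close>.\<close>

lemma bin_prob_log_expansion_pre2:
  assumes d: "0 < d" and K: "\<forall>p\<in>K. d \<le> p \<and> p \<le> 1 - d"
  shows "log_expansion K R bin_prob pre2_wd pre2 coeff2"
  unfolding log_expansion_def
proof
  fix M
  define T where "T = real R + 1"
  obtain C N0 where C: "\<forall>N\<ge>N0. \<forall>p\<in>K. \<forall>r. \<bar>r\<bar> \<le> int R \<longrightarrow>
     0 < nu N p + r \<and> nu N p + r < int N \<and> 0 < bin_prob N p r \<and>
     \<bar>ln (bin_prob N p r)
       - ((ln N + ln p - ln (1 - p)) / 2 - ln (of_int (nu N p + r)) - ln (2 * pi) / 2
          + (\<Sum>k=1..M. coeff1 N p r k / real N ^ k))\<bar> \<le> C / real N ^ (M + 1)"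
    using bin_prob_log_expansion[OF d K, where R = R and M = M] by (elim exE)
  obtain C2 where C2: "\<forall>y::real. \<bar>y\<bar> \<le> 1 / 2 \<longrightarrow>
      \<bar>ln (1 + y) - (\<Sum>k=1..M. (- 1) ^ (k + 1) * y ^ k / real k)\<bar> \<le> C2 * \<bar>y\<bar> ^ (M + 1)"
    using ln_one_plus_truncation ..
  define C3 where "C3 = \<bar>C2\<bar> * (T / d) ^ (M + 1)"
  obtain N1 :: nat where N1: "2 * T / d \<le> real N1" using real_arch_simple by blast
  \<comment> \<open>The argument is at most T/(d N) in absolute value, and N1 makes that at most
    1/2.\<close>
  have log_bound: "\<bar>ln (1 + s / (real N * x)) - (\<Sum>k=1..M. (- 1) ^ (k + 1) * (s / (real N * x)) ^ k / real k)\<bar>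
      \<le> C3 / real N ^ (M + 1) \<and> 0 < 1 + s / (real N * x)"
    if "N \<ge> N1" "0 < real N" "d \<le> x" "\<bar>s\<bar> \<le> T" for N x s
  proof -
    define y where "y = s / (real N * x)"
    have "2 * T / d \<le> real N" using N1 that(1) by linarith
    then have NT: "T / d / real N \<le> 1 / 2" using d that(2) by (simp add: field_simps)
    have "\<bar>y\<bar> = \<bar>s\<bar> / (real N * x)" using that d by (simp add: y_def abs_mult)
    also have "\<dots> \<le> T / (real N * d)"
      using that d by (intro frac_le mult_left_mono) auto
    finally have y: "\<bar>y\<bar> \<le> T / d / real N" by (simp add: mult.commute)
    with NT have y2: "\<bar>y\<bar> \<le> 1 / 2" by linarith
    with C2 have "\<bar>ln (1 + y) - (\<Sum>k=1..M. (- 1) ^ (k + 1) * y ^ k / real k)\<bar> \<le> C2 * \<bar>y\<bar> ^ (M + 1)"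
      by blast
    also have "\<dots> \<le> \<bar>C2\<bar> * (T / d / real N) ^ (M + 1)"
      using y by (intro mult_mono power_mono) auto
    also have "\<dots> = C3 / real N ^ (M + 1)"
      by (simp add: C3_def power_divide power_mult_distrib)
    finally have "\<bar>ln (1 + y) - (\<Sum>k=1..M. (- 1) ^ (k + 1) * y ^ k / real k)\<bar> \<le> C3 / real N ^ (M + 1)" .
    moreover have "0 < 1 + y" using y2 by linarith
    ultimately show ?thesis by (simp only: y_def)
  qed
  show "\<exists>C N0. \<forall>N\<ge>N0. \<forall>p\<in>K. \<forall>r. \<bar>r\<bar> \<le> int R \<longrightarrow>
        pre2_wd N p r \<and> 0 < bin_prob N p r \<and> 0 < pre2 N p r \<and>
        \<bar>ln (bin_prob N p r) - (ln (pre2 N p r) + (\<Sum>k=1..M. coeff2 N p r k / real N ^ k))\<bar> \<le> C / real N ^ (M + 1)"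
  proof (rule exI[of _ "C + C3"], rule exI[of _ "max N0 N1"], intro allI ballI impI)
    fix N p and r :: int assume N: "max N0 N1 \<le> N" and p: "p \<in> K" and r: "\<bar>r\<bar> \<le> int R"
    define q where "q = 1 - p"
    from bspec[OF K p] have dpq: "d \<le> p" "d \<le> q" by (auto simp: q_def)
    with d have pq: "0 < p" "0 < q" by auto
    define m where "m = real_of_int (nu N p + r)"
    define s where "s = hh N p + of_int r"
    have *: "0 < nu N p + r" "nu N p + r < int N" "0 < bin_prob N p r"
      "\<bar>ln (bin_prob N p r) - ((ln N + ln p - ln q) / 2 - ln m - ln (2 * pi) / 2
          + (\<Sum>k=1..M. coeff1 N p r k / real N ^ k))\<bar> \<le> C / real N ^ (M + 1)"
      using C N p r by (auto simp: m_def q_def)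
    have m0: "m > 0" using *(1) by (simp add: m_def)
    have mN: "real N - m > 0"
    proof -
      have "real_of_int (nu N p + r) < real_of_int (int N)" using *(2) by (simp only: of_int_less_iff)
      then show ?thesis by (simp add: m_def)
    qed
    have N0: "real N > 0" using m0 mN by linarith
    have Nm: "real_of_int (int N - nu N p - r) = real N - m" by (simp add: m_def)
    have r0: "2 * pi * m * (real N - m) / real N > 0" using m0 mN N0 by simp
    have ln2: "ln (pre2 N p r) = - (ln (2 * pi) + ln m + ln (real N - m) - ln N) / 2"
    proof -
      have "ln (1 / sqrt X) = - ln X / 2" if "X > 0" for X
        using that by (simp add: ln_div ln_sqrt)
      from this[OF r0] have "ln (pre2 N p r) = - ln (2 * pi * m * (real N - m) / real N) / 2"
        unfolding pre2_def Nm m_def[symmetric] .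
      moreover have "ln (2 * pi * m * (real N - m) / real N) = ln (2 * pi) + ln m + ln (real N - m) - ln N"
        using m0 mN N0 by (simp add: ln_mult ln_div)
      ultimately show ?thesis by (simp only:)
    qed
    have P0: "pre2 N p r > 0"
      unfolding pre2_def Nm m_def[symmetric] using r0 by simp
    have wd: "pre2_wd N p r"
      unfolding pre2_wd_def Nm m_def[symmetric] using r0 N0 by simp
    have sT: "\<bar>s\<bar> \<le> T" using offset_bound[OF r] by (simp add: s_def T_def)
    define L where "L = (\<lambda>y::real. \<Sum>k=1..M. (- 1) ^ (k + 1) * y ^ k / real k)"
    have b1: "\<bar>ln (1 + s / (real N * p)) - L (s / (real N * p))\<bar> \<le> C3 / real N ^ (M + 1)" "0 < 1 + s / (real N * p)"
      unfolding L_def using log_bound[of N p s] N N0 dpq sT by auto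
    have b2: "\<bar>ln (1 + (- s) / (real N * q)) - L ((- s) / (real N * q))\<bar> \<le> C3 / real N ^ (M + 1)" "0 < 1 + (- s) / (real N * q)"
      unfolding L_def using log_bound[of N q "- s"] N N0 dpq sT by auto
    have ms: "m = real N * p + s" by (simp add: m_def s_def hh_def)
    then have "m = real N * p * (1 + s / (real N * p))"
      using N0 pq by (simp add: field_simps)
    then have lm: "ln m = ln N + ln p + ln (1 + s / (real N * p))"
      using N0 pq b1(2) by (metis ln_mult_pos mult_pos_pos)
    have "real N - m = real N * q * (1 + (- s) / (real N * q))"
      using N0 pq(2) by (simp add: ms q_def field_simps)
    then have lNm: "ln (real N - m) = ln N + ln q + ln (1 + (- s) / (real N * q))"
      using N0 pq b2(2) by (metis ln_mult_pos mult_pos_pos)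
    have "(\<Sum>k=1..M. coeff2 N p r k / real N ^ k) = (\<Sum>k=1..M. coeff1 N p r k / real N ^ k
        + ((- 1) ^ (k + 1) * ((- s) / (real N * q)) ^ k / real k - (- 1) ^ (k + 1) * (s / (real N * p)) ^ k / real k) / 2)"
    proof (intro sum.cong refl)
      fix k assume k: "k \<in> {1..M}"
      have "(- 1) ^ (k + 1) * ((- s) / (real N * q)) ^ k = - (s ^ k / (real N ^ k * q ^ k))"
        by (simp add: power_divide power_mult_distrib power_minus[of s] flip: power_mult_distrib mult.assoc)
      moreover have "(c - (e / P + 1 / Q) * S / (2 * i)) / n = c / n + (- (S / (n * Q)) / i - e * (S / (n * P)) / i) / 2"
        for c e P Q S i n :: real
        by (simp add: diff_divide_distrib add_divide_distrib distrib_left distrib_right mult_ac)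
      ultimately show "coeff2 N p r k / real N ^ k = coeff1 N p r k / real N ^ k
        + ((- 1) ^ (k + 1) * ((- s) / (real N * q)) ^ k / real k - (- 1) ^ (k + 1) * (s / (real N * p)) ^ k / real k) / 2"
        using k by (simp only: coeff2_eq atLeastAtMost_iff s_def[symmetric] Xi_def q_def[symmetric] power_divide power_mult_distrib)
    qed
    also have "\<dots> = (\<Sum>k=1..M. coeff1 N p r k / real N ^ k) + (L ((- s) / (real N * q)) - L (s / (real N * p))) / 2"
      unfolding L_def sum.distrib sum_subtractf[symmetric] sum_divide_distrib[symmetric] by simp
    finally have "ln (bin_prob N p r) - (ln (pre2 N p r) + (\<Sum>k=1..M. coeff2 N p r k / real N ^ k))
      = (ln (bin_prob N p r) - ((ln N + ln p - ln q) / 2 - ln m - ln (2 * pi) / 2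
          + (\<Sum>k=1..M. coeff1 N p r k / real N ^ k)))
        + ((ln (1 + (- s) / (real N * q)) - L ((- s) / (real N * q))) - (ln (1 + s / (real N * p)) - L (s / (real N * p)))) / 2"
      unfolding ln2 lm lNm by (simp add: field_simps)
    \<comment> \<open>Each of the two logarithmic errors enters with weight 1/2, so together they
      cost a single \<open>C3\<close>.\<close>
    moreover have "\<bar>x + (z - y) / 2\<bar> \<le> c + e" if "\<bar>x\<bar> \<le> c" "\<bar>y\<bar> \<le> e" "\<bar>z\<bar> \<le> e" for x y z c e :: real
      using that unfolding abs_le_iff by (simp add: field_simps)
    from this[OF *(4) b1(1) b2(1)] have "\<bar>(ln (bin_prob N p r) - ((ln N + ln p - ln q) / 2 - ln m - ln (2 * pi) / 2
          + (\<Sum>k=1..M. coeff1 N p r k / real N ^ k)))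
        + ((ln (1 + (- s) / (real N * q)) - L ((- s) / (real N * q))) - (ln (1 + s / (real N * p)) - L (s / (real N * p)))) / 2\<bar>
        \<le> (C + C3) / real N ^ (M + 1)"
      by (simp only: add_divide_distrib)
    ultimately have "\<bar>ln (bin_prob N p r) - (ln (pre2 N p r) + (\<Sum>k=1..M. coeff2 N p r k / real N ^ k))\<bar>
        \<le> (C + C3) / real N ^ (M + 1)"
      by (simp only:)
    with wd *(3) P0 show "pre2_wd N p r \<and> 0 < bin_prob N p r \<and> 0 < pre2 N p r \<and>
        \<bar>ln (bin_prob N p r) - (ln (pre2 N p r) + (\<Sum>k=1..M. coeff2 N p r k / real N ^ k))\<bar> \<le> (C + C3) / real N ^ (M + 1)"
      by simp
  qed
qed

section \<open>Uniform bounds on the coefficients\<close>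

lemma Xi_bound:
  assumes "0 < d" "d \<le> p" "p \<le> 1 - d"
  shows "\<bar>Xi k p\<bar> \<le> 2 / d ^ k"
proof -
  have "\<bar>Xi k p\<bar> \<le> \<bar>(- 1) ^ (k + 1) / p ^ k\<bar> + \<bar>1 / (1 - p) ^ k\<bar>"
    unfolding Xi_def by (rule abs_triangle_ineq)
  also have "\<dots> = 1 / p ^ k + 1 / (1 - p) ^ k"
    using assms by (simp add: abs_divide power_abs)
  also have "\<dots> \<le> 1 / d ^ k + 1 / d ^ k"
    using assms by (intro add_mono frac_le power_mono) auto
  finally show ?thesis by simp
qed

text \<open>By \<open>coeff1_eq\<close>, N and r enter only through the offset, which stays within R
  + 1 of 0. This bounds the Bernoulli value, and d bounds \<open>Xi\<close>.\<close>

lemma coeffs_bounded_coeff1: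
  assumes d: "0 < d" and K: "\<forall>p\<in>K. d \<le> p \<and> p \<le> 1 - d"
  shows "coeffs_bounded K R coeff1"
  unfolding coeffs_bounded_def
proof (intro allI impI)
  fix k :: nat assume k: "k \<ge> 1"
  obtain B where B: "B > 0" "\<forall>t. \<bar>t\<bar> \<le> real R + 1 \<longrightarrow> \<bar>bernpoly (k + 1) t\<bar> \<le> B"
    using bernpoly_bounded by blast
  show "\<exists>A. \<forall>N. \<forall>p\<in>K. \<forall>r. \<bar>r\<bar> \<le> int R \<longrightarrow> \<bar>coeff1 N p r k\<bar> \<le> A"
  proof (rule exI[of _ "\<bar>bernoulli (k + 1)\<bar> + 2 / d ^ k * B"], intro allI ballI impI)
    fix N p and r :: int assume p: "p \<in> K" and r: "\<bar>r\<bar> \<le> int R"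
    define s where "s = hh N p + of_int r"
    have Xi: "\<bar>Xi k p\<bar> \<le> 2 / d ^ k" using Xi_bound[of d p k] bspec[OF K p] d by simp
    have "\<bar>bernpoly (k + 1) s\<bar> \<le> B" using B offset_bound[OF r] by (simp add: s_def)
    then have X: "\<bar>Xi k p * bernpoly (k + 1) s\<bar> \<le> 2 / d ^ k * B"
      unfolding abs_mult using Xi d by (intro mult_mono) auto
    have "\<bar>coeff1 N p r k\<bar> = \<bar>(- 1) ^ (k + 1) * bernoulli (k + 1) - Xi k p * bernpoly (k + 1) s\<bar> / (real k * real (k + 1))"
      unfolding coeff1_eq[OF k] coeff_at_def s_def by (simp add: abs_mult)
    also have "\<dots> \<le> (\<bar>bernoulli (k + 1)\<bar> + 2 / d ^ k * B) / 1"
    proof (rule frac_le)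
      have "\<bar>(- 1) ^ (k + 1) * bernoulli (k + 1)\<bar> = \<bar>bernoulli (k + 1)\<bar>" by (simp add: abs_mult)
      with X show "\<bar>(- 1) ^ (k + 1) * bernoulli (k + 1) - Xi k p * bernpoly (k + 1) s\<bar> \<le> \<bar>bernoulli (k + 1)\<bar> + 2 / d ^ k * B"
        by linarith
      have "1 * 1 \<le> real k * real (k + 1)" using k by (intro mult_mono) auto
      then show "1 \<le> real k * real (k + 1)" by simp
    qed (use B d in auto)
    finally show "\<bar>coeff1 N p r k\<bar> \<le> \<bar>bernoulli (k + 1)\<bar> + 2 / d ^ k * B" by simp
  qed
qed

lemma coeffs_bounded_coeff2:
  assumes d: "0 < d" and K: "\<forall>p\<in>K. d \<le> p \<and> p \<le> 1 - d"
  shows "coeffs_bounded K R coeff2"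
  unfolding coeffs_bounded_def
proof (intro allI impI)
  fix k :: nat assume k: "k \<ge> 1"
  obtain A where A: "\<And>N p r. p \<in> K \<Longrightarrow> \<bar>r\<bar> \<le> int R \<Longrightarrow> \<bar>coeff1 N p r k\<bar> \<le> A"
    using coeffs_bounded_coeff1[OF d K, of R] k unfolding coeffs_bounded_def by metis
  show "\<exists>A. \<forall>N. \<forall>p\<in>K. \<forall>r. \<bar>r\<bar> \<le> int R \<longrightarrow> \<bar>coeff2 N p r k\<bar> \<le> A"
  proof (rule exI[of _ "A + 2 / d ^ k * (real R + 1) ^ k"], intro allI ballI impI)
    fix N p and r :: int assume p: "p \<in> K" and r: "\<bar>r\<bar> \<le> int R"
    define s where "s = hh N p + of_int r"
    have Xi: "\<bar>Xi k p\<bar> \<le> 2 / d ^ k" using Xi_bound[of d p k] bspec[OF K p] d by simp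
    have "\<bar>s\<bar> ^ k \<le> (real R + 1) ^ k" using offset_bound[OF r] by (intro power_mono) (auto simp: s_def)
    then have "\<bar>Xi k p\<bar> * \<bar>s\<bar> ^ k \<le> 2 / d ^ k * (real R + 1) ^ k"
      using Xi d by (intro mult_mono) auto
    moreover have "\<bar>Xi k p\<bar> * \<bar>s\<bar> ^ k / (2 * real k) \<le> \<bar>Xi k p\<bar> * \<bar>s\<bar> ^ k / 1"
      using k by (intro frac_le) auto
    moreover have "\<bar>Xi k p * s ^ k / (2 * real k)\<bar> = \<bar>Xi k p\<bar> * \<bar>s\<bar> ^ k / (2 * real k)"
      by (simp add: abs_mult power_abs)
    ultimately have "\<bar>Xi k p * s ^ k / (2 * real k)\<bar> \<le> 2 / d ^ k * (real R + 1) ^ k" by linarith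
    with A[OF p r, of N] show "\<bar>coeff2 N p r k\<bar> \<le> A + 2 / d ^ k * (real R + 1) ^ k"
      unfolding coeff2_eq[OF k] s_def by linarith
  qed
qed

theorem theorem5p1:
  fixes R :: nat and K :: "real set"
  assumes "compact K" and "K \<subseteq> {0<..<1}"
  shows "exp_expansion K R bin_prob pre1_wd pre1 coeff1
       \<and> exp_expansion K R bin_prob pre2_wd pre2 coeff2
       \<and> series_expansion K R bin_prob pre1_wd pre1 coeff1
       \<and> series_expansion K R bin_prob pre2_wd pre2 coeff2
       \<and> (\<forall>a. exp_coeff a 0 = 1)
       \<and> (\<forall>n. \<exists>(F :: (nat \<Rightarrow> nat) set) c. finite F \<and>
             (\<forall>a. exp_coeff a n = (\<Sum>m\<in>F. c m * (\<Prod>k=1..n. a k ^ m k))))"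
proof -
  obtain d where d: "d > 0" and K: "\<forall>p\<in>K. d \<le> p \<and> p \<le> 1 - d"
    using compact_subset_open_unit_interval[OF assms] by blast
  have e1: "exp_expansion K R bin_prob pre1_wd pre1 coeff1"
    by (rule exp_expansion_of_log[OF bin_prob_log_expansion_pre1[OF d K]])
  have e2: "exp_expansion K R bin_prob pre2_wd pre2 coeff2"
    by (rule exp_expansion_of_log[OF bin_prob_log_expansion_pre2[OF d K]])
  have "polynomial_in n (\<lambda>a. exp_coeff a n)" for n
    by (rule polynomial_in_exp_coeff) simp
  then show ?thesis
    unfolding polynomial_in_def
    using e1 e2 series_expansion_of_exp[OF e1 coeffs_bounded_coeff1[OF d K]]
      series_expansion_of_exp[OF e2 coeffs_bounded_coeff2[OF d K]] exp_coeff_0 by blast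
qed

end
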